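(* Consider the regularized estimation problem described in the context, with norm $\Psi$, true parameter $\theta_*$, estimator $\widehat\theta_N$, positive constants $\Lambda_Q,\Lambda_M,\Lambda_{\mathcal V}$, probabilities $p_{\mathcal Q},p_{\mathcal M}\in(0,1)$, radius $r(\rho)$, and quantity $\Delta(\theta_*,\rho)$. (1) Suppose there exist $\rho>0$ and $\lambda$ with $c_1\frac{r(\rho)^2}{\rho}\le\lambda\le c_2\frac{r(\rho)^2}{\rho}$ for some constants $c_1,c_2$ such that $\Lambda_Q>\Lambda_M+\Lambda_{\mathcal V}+c_2$, $c_1\ge8(\Lambda_M+\Lambda_{\mathcal V})$ and $\Delta(\theta_*,\rho)\ge\frac34\rho$. Then, with probability at least $1-p_{\mathcal Q}-p_{\mathcal M}$, for any $\theta\notin B_2(\theta_*,r(\rho))\cap B_\Psi(\theta_*,\rho)$ one has $\mathcal P_N\mathcal L^\lambda_{\theta-\theta_*}>0$. (2) Furthermore, if $\rho=c\,\Psi(\theta_* )$ for some absolute constant $c>4$, $\lambda\ge c_1\frac{r(\rho)^2}{\rho}$ with $c_1>8(\Lambda_M+\Lambda_{\mathcal V})$, and $\Lambda_Q>\Lambda_M+\Lambda_{\mathcal V}$, then, with probability at least $1-p_{\mathcal Q}-p_{\mathcal M}$, $$\|\widehat\theta_N-\theta_*\|_2\le\max\left\{r(\rho),\ \frac{\lambda}{r(\rho)(\Lambda_Q-\Lambda_M-\Lambda_{\mathcal V})}\Psi(\theta_* )\right\}.$$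
   Context: Model: $(\mathbf x_i,y_i)_{i=1}^N$ are i.i.d. copies of $(\mathbf x,y)\in\mathbb R^d\times\mathbb R$, where conditionally on $\mathbf x$ the response has an exponential-family distribution $\Pr(y\mid\mathbf x;\theta_*,\sigma)\propto\exp\big((y\langle\mathbf x,\theta_*\rangle-g(\langle\mathbf x,\theta_*\rangle))/c(\sigma)\big)$ (factor depending only on $y,\sigma$), with $g:\mathbb R\to\mathbb R$ twice differentiable and $g''>0$. $\widetilde{\mathbf x}$ denotes the coordinatewise truncation $\widetilde x_j=\mathrm{sign}(x_j)(|x_j|\wedge\tau)$, $\tau=(N/\log(ed))^{1/4}$, of $\mathbf x$. $\Psi$ is a norm on $\mathbb R^d$ and $$\widehat\theta_N:=\operatorname*{argmin}_{\theta\in\mathbb R^d}\Big[-\frac1N\sum_{i=1}^Ny_i\langle\widetilde{\mathbf x}_i,\theta\rangle+\frac1N\sum_{i=1}^Ng(\langle\widetilde{\mathbf x}_i,\theta\rangle)+\lambda\Psi(\theta)\Big].$$ For $\mathbf v\in\mathbb R^d$ put $\mathcal Q_{\mathbf v}(\mathbf x)=g(\langle\widetilde{\mathbf x},\theta_*+\mathbf v\rangle)-g(\langle\widetilde{\mathbf x},\theta_*\rangle)-g'(\langle\widetilde{\mathbf x},\theta_*\rangle)\langle\widetilde{\mathbf x},\mathbf v\rangle$, $\mathcal V_{\mathbf v}=\mathbb E\big[(y-g'(\langle\widetilde{\mathbf x},\theta_*\rangle))\langle\widetilde{\mathbf x},\mathbf v\rangle\big]$, $\mathcal M_{\mathbf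 v}(\mathbf x)=(y-g'(\langle\widetilde{\mathbf x},\theta_*\rangle))\langle\widetilde{\mathbf x},\mathbf v\rangle-\mathcal V_{\mathbf v}$, $\mathcal L^\lambda_{\mathbf v}(\mathbf x)=\mathcal Q_{\mathbf v}(\mathbf x)-\mathcal M_{\mathbf v}(\mathbf x)-\mathcal V_{\mathbf v}+\lambda(\Psi(\theta_*+\mathbf v)-\Psi(\theta_* ))$, and let $\mathcal P_N$ denote the empirical average over the $N$ samples. $B_2(\mathbf z,r)$, $S_2(\mathbf z,r)$ (resp. $B_\Psi$, $S_\Psi$) are the ball and sphere of radius $r$ centered at $\mathbf z$ in the Euclidean norm (resp. in $\Psi$). For given $\rho>0$ define $$r_{\mathcal Q}=\inf\Big\{r>0:\Pr\Big(\inf_{\theta\in S_2(\theta_*,r)\cap B_\Psi(\theta_*,\rho)}\mathcal P_N\mathcal Q_{\theta-\theta_*}\ge\Lambda_Qr^2\Big)\ge1-p_{\mathcal Q}\Big\},$$ $$r_{\mathcal V}=\inf\Big\{r>0:\sup_{\theta\in B_2(\theta_*,r)\cap B_\Psi(\theta_*,\rho)}|\mathcal V_{\theta-\theta_*}|\le\Lambda_{\mathcal V}r^2\Big\},$$ $$r_{\mathcal M}=\inf\Big\{r>0:\Pr\Big(\sup_{\theta\in B_2(\theta_*,r)\cap B_\Psi(\theta_*,\rho)}|\mathcal P_N\mathcal M_{\theta-\theta_*}|\le\Lambda_Mr^2\Big)\ge1-p_{\mathcal M}\Big\},$$ and $r(\rho)=\max\{r_{\mathcal Q},r_{\mathcal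 M},r_{\mathcal V}\}$. Let $\Gamma_\Psi(\theta_*,\rho)$ be the set of all $\mathbf z\in\mathbb R^d$ for which there is $\mathbf u\in B_\Psi(\theta_*,\rho/4)$ with $\Psi(\mathbf u+\Delta\mathbf u)-\Psi(\mathbf u)\ge\langle\mathbf z,\Delta\mathbf u\rangle$ for all $\Delta\mathbf u\in\mathbb R^d$ (subgradients of $\Psi$ at points of $B_\Psi(\theta_*,\rho/4)$), and $$\Delta(\theta_*,\rho)=\inf_{\theta\in B_2(\theta_*,r(\rho))\cap S_\Psi(\theta_*,\rho)}\ \sup_{\mathbf z\in\Gamma_\Psi(\theta_*,\rho)}\langle\mathbf z,\theta-\theta_*\rangle .$$
   Formalization: Both parts additionally assume that if r(ρ) exceeds r_Q, then r(ρ) itself satisfies the probability condition defining r_Q; without this the claim is false (e.g. Poisson responses, g = exp), as that condition need not persist for radii above r_Q. *)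

theory Defs
  imports "HOL-Probability.Probability"
begin

definition is_norm :: "(real ^ 'd \<Rightarrow> real) \<Rightarrow> bool" where
  "is_norm \<Psi> \<longleftrightarrow>
     (\<forall>v. 0 \<le> \<Psi> v) \<and> (\<forall>v. \<Psi> v = 0 \<longleftrightarrow> v = 0) \<and>
     (\<forall>a v. \<Psi> (a *\<^sub>R v) = \<bar>a\<bar> * \<Psi> v) \<and> (\<forall>v w. \<Psi> (v + w) \<le> \<Psi> v + \<Psi> w)"

(* Euclidean balls and spheres are the library's cball and sphere; all balls are closed. *)
definition norm_ball :: "(real ^ 'd \<Rightarrow> real) \<Rightarrow> real ^ 'd \<Rightarrow> real \<Rightarrow> (real ^ 'd) set" where
  "norm_ball \<Psi> z r = {\<theta>. \<Psi> (\<theta> - z) \<le> r}"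

definition norm_sphere :: "(real ^ 'd \<Rightarrow> real) \<Rightarrow> real ^ 'd \<Rightarrow> real \<Rightarrow> (real ^ 'd) set" where
  "norm_sphere \<Psi> z r = {\<theta>. \<Psi> (\<theta> - z) = r}"

definition trunc_level :: "nat \<Rightarrow> nat \<Rightarrow> real" where
  "trunc_level N d = (real N / ln (exp 1 * real d)) powr (1/4)"

definition truncated :: "nat \<Rightarrow> real ^ 'd \<Rightarrow> real ^ 'd" where
  "truncated N x = (\<chi> j. sgn (x $ j) * min \<bar>x $ j\<bar> (trunc_level N CARD('d)))"

(* D is the law of (x, y) and Z 1, ..., Z N are the i.i.d. copies of (x, y), living on M.
   The penultimate conjunct is the exponential family model: given x, the response y has
   density exp ((y <x, ts> - g <x, ts>) / c s) with respect to a base measure nu s that does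
   not depend on x (it absorbs the factor depending on y and s only, and may be discrete or
   continuous).  The last conjunct says that the expectation defining drift_V exists. *)
definition glm_sample ::
  "'a measure \<Rightarrow> nat \<Rightarrow> (nat \<Rightarrow> 'a \<Rightarrow> (real ^ 'd) \<times> real) \<Rightarrow> ((real ^ 'd) \<times> real) measure \<Rightarrow>
   (real \<Rightarrow> real) \<Rightarrow> (real \<Rightarrow> real) \<Rightarrow> real \<Rightarrow> (real \<Rightarrow> real measure) \<Rightarrow> real ^ 'd \<Rightarrow> bool" where
  "glm_sample M N Z D g c \<sigma> \<nu> \<theta>s \<longleftrightarrow>
     prob_space M \<and> 0 < N \<and>
     prob_space.indep_vars M (\<lambda>_. borel) Z {1..N} \<and>
     (\<forall>i\<in>{1..N}. distr M borel (Z i) = D) \<and>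
     (\<forall>t. g differentiable (at t)) \<and> (\<forall>t. deriv g differentiable (at t)) \<and>
     (\<forall>t. 0 < deriv (deriv g) t) \<and>
     0 < c \<sigma> \<and> sigma_finite_measure (\<nu> \<sigma>) \<and> sets (\<nu> \<sigma>) = sets borel \<and>
     D = density (distr D borel fst \<Otimes>\<^sub>M \<nu> \<sigma>)
           (\<lambda>(x, y). ennreal (exp ((y * (x \<bullet> \<theta>s) - g (x \<bullet> \<theta>s)) / c \<sigma>))) \<and>
     (\<forall>v. integrable D
        (\<lambda>(x, y). (y - deriv g (truncated N x \<bullet> \<theta>s)) * (truncated N x \<bullet> v)))"

definition emp_avg :: "nat \<Rightarrow> (nat \<Rightarrow> 'a \<Rightarrow> 'b) \<Rightarrow> ('b \<Rightarrow> real) \<Rightarrow> 'a \<Rightarrow> real" where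
  "emp_avg N Z f \<omega> = (\<Sum>i=1..N. f (Z i \<omega>)) / real N"

definition objective ::
  "(real \<Rightarrow> real) \<Rightarrow> (real ^ 'd \<Rightarrow> real) \<Rightarrow> nat \<Rightarrow> (nat \<Rightarrow> 'a \<Rightarrow> (real ^ 'd) \<times> real) \<Rightarrow> real \<Rightarrow>
   'a \<Rightarrow> real ^ 'd \<Rightarrow> real" where
  "objective g \<Psi> N Z lam \<omega> \<theta> =
     - emp_avg N Z (\<lambda>(x, y). y * (truncated N x \<bullet> \<theta>)) \<omega>
     + emp_avg N Z (\<lambda>(x, y). g (truncated N x \<bullet> \<theta>)) \<omega> + lam * \<Psi> \<theta>"

(* The minimizer need not be unique: this is the set-valued argmin. *)
definition estimators ::
  "(real \<Rightarrow> real) \<Rightarrow> (real ^ 'd \<Rightarrow> real) \<Rightarrow> nat \<Rightarrow> (nat \<Rightarrow> 'a \<Rightarrow> (real ^ 'd) \<times> real) \<Rightarrow> real \<Rightarrow>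
   'a \<Rightarrow> (real ^ 'd) set" where
  "estimators g \<Psi> N Z lam \<omega> = {\<theta>. is_arg_min (objective g \<Psi> N Z lam \<omega>) (\<lambda>_. True) \<theta>}"

definition quad_Q ::
  "(real \<Rightarrow> real) \<Rightarrow> nat \<Rightarrow> real ^ 'd \<Rightarrow> real ^ 'd \<Rightarrow> (real ^ 'd) \<times> real \<Rightarrow> real" where
  "quad_Q g N \<theta>s v = (\<lambda>(x, y).
     g (truncated N x \<bullet> (\<theta>s + v)) - g (truncated N x \<bullet> \<theta>s)
     - deriv g (truncated N x \<bullet> \<theta>s) * (truncated N x \<bullet> v))"

definition drift_V ::
  "((real ^ 'd) \<times> real) measure \<Rightarrow> (real \<Rightarrow> real) \<Rightarrow> nat \<Rightarrow> real ^ 'd \<Rightarrow> real ^ 'd \<Rightarrow> real" where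
  "drift_V D g N \<theta>s v =
     integral\<^sup>L D (\<lambda>(x, y). (y - deriv g (truncated N x \<bullet> \<theta>s)) * (truncated N x \<bullet> v))"

definition mult_M ::
  "((real ^ 'd) \<times> real) measure \<Rightarrow> (real \<Rightarrow> real) \<Rightarrow> nat \<Rightarrow> real ^ 'd \<Rightarrow> real ^ 'd \<Rightarrow>
   (real ^ 'd) \<times> real \<Rightarrow> real" where
  "mult_M D g N \<theta>s v = (\<lambda>(x, y).
     (y - deriv g (truncated N x \<bullet> \<theta>s)) * (truncated N x \<bullet> v) - drift_V D g N \<theta>s v)"

definition excess_L ::
  "((real ^ 'd) \<times> real) measure \<Rightarrow> (real \<Rightarrow> real) \<Rightarrow> (real ^ 'd \<Rightarrow> real) \<Rightarrow> nat \<Rightarrow> real ^ 'd \<Rightarrow>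
   real \<Rightarrow> real ^ 'd \<Rightarrow> (real ^ 'd) \<times> real \<Rightarrow> real" where
  "excess_L D g \<Psi> N \<theta>s lam v z =
     quad_Q g N \<theta>s v z - mult_M D g N \<theta>s v z - drift_V D g N \<theta>s v
     + lam * (\<Psi> (\<theta>s + v) - \<Psi> \<theta>s)"

(* Inner infima and suprema are taken in ereal, so that the infimum over an empty set is +infinity.
   The three sets of radii below are then nonempty (they contain all large r, provided
   0 < p, 0 < L and 0 < rho) and bounded below by 0, so their real infima are genuine.
   levels_M and levels_V are upward closed because v enters linearly there; levels_Q need not be,
   since convexity only gives quad_Q a linear growth rate along rays.  A radius above
   radius_Q therefore need not belong to levels_Q. *)
definition levels_Q ::
  "'a measure \<Rightarrow> (nat \<Rightarrow> 'a \<Rightarrow> (real ^ 'd) \<times> real) \<Rightarrow> (real \<Rightarrow> real) \<Rightarrow> (real ^ 'd \<Rightarrow> real) \<Rightarrow>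
   nat \<Rightarrow> real ^ 'd \<Rightarrow> real \<Rightarrow> real \<Rightarrow> real \<Rightarrow> real set" where
  "levels_Q M Z g \<Psi> N \<theta>s L p \<rho> = {r. 0 < r \<and>
     1 - p \<le> measure M {\<omega> \<in> space M.
       (INF \<theta> \<in> sphere \<theta>s r \<inter> norm_ball \<Psi> \<theta>s \<rho>.
          ereal (emp_avg N Z (quad_Q g N \<theta>s (\<theta> - \<theta>s)) \<omega>)) \<ge> ereal (L * r\<^sup>2)}}"

definition levels_V ::
  "((real ^ 'd) \<times> real) measure \<Rightarrow> (real \<Rightarrow> real) \<Rightarrow> (real ^ 'd \<Rightarrow> real) \<Rightarrow> nat \<Rightarrow> real ^ 'd \<Rightarrow>
   real \<Rightarrow> real \<Rightarrow> real set" where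
  "levels_V D g \<Psi> N \<theta>s L \<rho> = {r. 0 < r \<and>
     (SUP \<theta> \<in> cball \<theta>s r \<inter> norm_ball \<Psi> \<theta>s \<rho>.
        ereal \<bar>drift_V D g N \<theta>s (\<theta> - \<theta>s)\<bar>) \<le> ereal (L * r\<^sup>2)}"

definition levels_M ::
  "'a measure \<Rightarrow> (nat \<Rightarrow> 'a \<Rightarrow> (real ^ 'd) \<times> real) \<Rightarrow> ((real ^ 'd) \<times> real) measure \<Rightarrow>
   (real \<Rightarrow> real) \<Rightarrow> (real ^ 'd \<Rightarrow> real) \<Rightarrow> nat \<Rightarrow> real ^ 'd \<Rightarrow> real \<Rightarrow> real \<Rightarrow> real \<Rightarrow>
   real set" where
  "levels_M M Z D g \<Psi> N \<theta>s L p \<rho> = {r. 0 < r \<and>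
     1 - p \<le> measure M {\<omega> \<in> space M.
       (SUP \<theta> \<in> cball \<theta>s r \<inter> norm_ball \<Psi> \<theta>s \<rho>.
          ereal \<bar>emp_avg N Z (mult_M D g N \<theta>s (\<theta> - \<theta>s)) \<omega>\<bar>) \<le> ereal (L * r\<^sup>2)}}"

definition radius_Q ::
  "'a measure \<Rightarrow> (nat \<Rightarrow> 'a \<Rightarrow> (real ^ 'd) \<times> real) \<Rightarrow> (real \<Rightarrow> real) \<Rightarrow> (real ^ 'd \<Rightarrow> real) \<Rightarrow>
   nat \<Rightarrow> real ^ 'd \<Rightarrow> real \<Rightarrow> real \<Rightarrow> real \<Rightarrow> real" where
  "radius_Q M Z g \<Psi> N \<theta>s LQ pQ \<rho> = Inf (levels_Q M Z g \<Psi> N \<theta>s LQ pQ \<rho>)"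

definition radius ::
  "'a measure \<Rightarrow> (nat \<Rightarrow> 'a \<Rightarrow> (real ^ 'd) \<times> real) \<Rightarrow> ((real ^ 'd) \<times> real) measure \<Rightarrow>
   (real \<Rightarrow> real) \<Rightarrow> (real ^ 'd \<Rightarrow> real) \<Rightarrow> nat \<Rightarrow> real ^ 'd \<Rightarrow> real \<Rightarrow> real \<Rightarrow> real \<Rightarrow>
   real \<Rightarrow> real \<Rightarrow> real \<Rightarrow> real" where
  "radius M Z D g \<Psi> N \<theta>s LQ LM LV pQ pM \<rho> =
     Max {radius_Q M Z g \<Psi> N \<theta>s LQ pQ \<rho>,
          Inf (levels_M M Z D g \<Psi> N \<theta>s LM pM \<rho>),
          Inf (levels_V D g \<Psi> N \<theta>s LV \<rho>)}"

definition subgradients ::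
  "(real ^ 'd \<Rightarrow> real) \<Rightarrow> real ^ 'd \<Rightarrow> real \<Rightarrow> (real ^ 'd) set" where
  "subgradients \<Psi> \<theta>s \<rho> =
     {z. \<exists>u \<in> norm_ball \<Psi> \<theta>s (\<rho> / 4). \<forall>h. \<Psi> (u + h) - \<Psi> u \<ge> z \<bullet> h}"

definition sparsity_Delta ::
  "(real ^ 'd \<Rightarrow> real) \<Rightarrow> real ^ 'd \<Rightarrow> real \<Rightarrow> real \<Rightarrow> ereal" where
  "sparsity_Delta \<Psi> \<theta>s r \<rho> =
     (INF \<theta> \<in> cball \<theta>s r \<inter> norm_sphere \<Psi> \<theta>s \<rho>.
        SUP z \<in> subgradients \<Psi> \<theta>s \<rho>. ereal (z \<bullet> (\<theta> - \<theta>s)))"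

end

theory Submission
  imports Defs
begin

text \<open>
  Along a ray from \<open>\<theta>s\<close> the empirical excess loss is convex and vanishes at the origin, so its
  sign beyond the intersection of the two balls is decided where the ray leaves that intersection.
  If it leaves through the Euclidean sphere of radius \<open>r\<close>, the quadratic term dominates; if it leaves
  through the \<open>\<Psi>\<close>-sphere of radius \<open>\<rho>\<close>, the quadratic term is nonnegative and the increment of the
  penalty dominates, by the sparsity equation in part 1 and by \<open>\<rho> > 4 * \<Psi> \<theta>s\<close> in part 2.

  The radius is an infimum that need not be attained and may be 0.  The linear terms satisfy
  \<open>\<bar>m w\<bar> \<le> L * s * max (norm w) (s * \<Psi> w / \<rho>)\<close> at every level \<open>s\<close>, which is closed under limits in
  \<open>s\<close>.  For the quadratic term one takes the event that infinitely many members of a sequence of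
  levels decreasing to \<open>r\<close> succeed; its probability is at least the infimum of the individual ones.
\<close>

section \<open>Deterministic estimates\<close>

lemma is_normD:
  assumes "is_norm \<Psi>"
  shows is_norm_nonneg: "0 \<le> \<Psi> v" and is_norm_eq_0: "\<Psi> v = 0 \<longleftrightarrow> v = 0"
    and is_norm_scale: "\<Psi> (a *\<^sub>R v) = \<bar>a\<bar> * \<Psi> v"
    and is_norm_triangle: "\<Psi> (v + w) \<le> \<Psi> v + \<Psi> w"
  using assms by (auto simp: is_norm_def)

lemma is_norm_minus: "is_norm \<Psi> \<Longrightarrow> \<Psi> (- v) = \<Psi> v"
  using is_norm_scale[of \<Psi> "-1" v] by simp

lemma is_norm_convex: "is_norm \<Psi> \<Longrightarrow> convex_on UNIV \<Psi>"
proof (rule convex_onI)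
  fix t :: real and x y assume "is_norm \<Psi>" "0 < t" "t < 1"
  then show "\<Psi> ((1 - t) *\<^sub>R x + t *\<^sub>R y) \<le> (1 - t) * \<Psi> x + t * \<Psi> y"
    using is_norm_triangle[of \<Psi> "(1 - t) *\<^sub>R x" "t *\<^sub>R y"] by (simp add: is_norm_scale)
qed simp

lemma is_norm_continuous: "is_norm \<Psi> \<Longrightarrow> continuous_on UNIV \<Psi>"
  using convex_on_continuous[OF open_UNIV is_norm_convex] by blast

text \<open>The norm \<open>\<Psi>\<close> attains a positive minimum on the compact Euclidean unit
  sphere, and the reciprocal of this minimum serves as \<open>C\<close>. It makes
  \<open>\<Psi>\<close>-balls bounded in the Euclidean sense.\<close>

lemma is_norm_bounds_norm:
  fixes \<Psi> :: "real ^ 'd \<Rightarrow> real"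
  assumes "is_norm \<Psi>"
  obtains C where "0 < C" "\<And>v. norm v \<le> C * \<Psi> v"
proof -
  have "compact (sphere (0 :: real ^ 'd) 1)" "sphere (0 :: real ^ 'd) 1 \<noteq> {}" by auto
  moreover have "continuous_on (sphere 0 1) \<Psi>"
    using is_norm_continuous[OF assms] continuous_on_subset by blast
  ultimately obtain u where u: "u \<in> sphere 0 1" "\<And>x. x \<in> sphere 0 1 \<Longrightarrow> \<Psi> u \<le> \<Psi> x"
    using continuous_attains_inf[of "sphere 0 1" \<Psi>] by blast
  have "u \<noteq> 0" using u(1) by auto
  then have pos: "0 < \<Psi> u"
    using is_norm_nonneg[OF assms, of u] is_norm_eq_0[OF assms, of u] by linarith
  have "norm v \<le> 1 / \<Psi> u * \<Psi> v" for v
  proof (cases "v = 0")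
    case False
    then have "\<Psi> u \<le> \<Psi> ((1 / norm v) *\<^sub>R v)" by (intro u(2)) auto
    then show ?thesis using False pos by (simp add: is_norm_scale[OF assms] field_simps)
  qed (use pos is_norm_nonneg[OF assms] in auto)
  then show thesis using pos that[of "1 / \<Psi> u"] by auto
qed

text \<open>The point \<open>a + v\<close> is the convex combination of \<open>a\<close> and
  \<open>a + t *\<^sub>R v\<close> with weight \<open>1 / t\<close> on the latter. Applied to
  \<open>g\<close> it gives linear growth of the quadratic term along rays; applied to
  \<open>\<Psi>\<close> it does the same for the penalty.\<close>

lemma convex_on_scale_increment:
  fixes f :: "'v::real_vector \<Rightarrow> real"
  assumes "convex_on UNIV f" "1 \<le> t"
  shows "t * (f (a + v) - f a) \<le> f (a + t *\<^sub>R v) - f a"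
proof -
  have "a + v = (1 - 1 / t) *\<^sub>R a + (1 / t) *\<^sub>R (a + t *\<^sub>R v)"
    using assms(2) by (simp add: algebra_simps)
  then have "f (a + v) \<le> (1 - 1 / t) * f a + (1 / t) * f (a + t *\<^sub>R v)"
    using convex_onD[OF assms(1), of "1 / t" a "a + t *\<^sub>R v"] assms(2) by simp
  then show ?thesis using assms(2) by (simp add: field_simps)
qed

lemma is_norm_increment_ge:
  assumes "is_norm \<Psi>"
  shows "\<Psi> (\<theta> + v) - \<Psi> \<theta> \<ge> - \<Psi> v"
  using is_norm_triangle[OF assms, of "\<theta> + v" "- v"] is_norm_minus[OF assms, of v] by simp

text \<open>The right-hand side is monotone and continuous in \<open>s\<close> and makes sense at \<open>s = 0\<close>, so unlike
  the left-hand side it passes to the infimum of the admissible \<open>s\<close>.\<close>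

lemma linear_bound_on_balls_iff:
  assumes "is_norm \<Psi>" "linear m" "0 < s" "0 < \<rho>" "0 \<le> L"
  shows "(\<forall>\<theta>\<in>cball \<theta>s s \<inter> norm_ball \<Psi> \<theta>s \<rho>. \<bar>m (\<theta> - \<theta>s)\<bar> \<le> L * s\<^sup>2) \<longleftrightarrow>
    (\<forall>w. \<bar>m w\<bar> \<le> L * s * max (norm w) (s * \<Psi> w / \<rho>))" (is "?A \<longleftrightarrow> ?B")
proof
  assume A: ?A
  show ?B
  proof
    fix w
    show "\<bar>m w\<bar> \<le> L * s * max (norm w) (s * \<Psi> w / \<rho>)"
    proof (cases "w = 0")
      case True
      then show ?thesis using linear_0[OF assms(2)] is_norm_eq_0[OF assms(1), of 0] by simp
    next
      case False
      \<comment> \<open>Up to the factor \<open>s\<close>, \<open>c\<close> is the gauge of the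
        intersection of the two balls: rescaling \<open>w\<close> by \<open>s / c\<close> puts it
        into both of them, and linearity of \<open>m\<close> undoes the rescaling.\<close>
      define c where "c = max (norm w) (s * \<Psi> w / \<rho>)"
      have c: "0 < c" "norm w \<le> c" "s * \<Psi> w \<le> \<rho> * c"
        using False assms(3,4) by (auto simp: c_def less_max_iff_disj pos_divide_le_eq[symmetric] mult.commute[of \<rho>])
      have "\<theta>s + (s / c) *\<^sub>R w \<in> cball \<theta>s s \<inter> norm_ball \<Psi> \<theta>s \<rho>"
        using c assms(3) by (auto simp: dist_norm norm_ball_def is_norm_scale[OF assms(1)] field_simps)
      from A[rule_format, OF this] have "\<bar>m ((s / c) *\<^sub>R w)\<bar> \<le> L * s\<^sup>2" by simp
      then show ?thesis
        using c assms(3) unfolding c_def[symmetric]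
        by (simp add: linear_scale[OF assms(2)] abs_mult field_simps power2_eq_square)
    qed
  qed
next
  assume B: ?B
  show ?A
  proof
    fix \<theta> assume "\<theta> \<in> cball \<theta>s s \<inter> norm_ball \<Psi> \<theta>s \<rho>"
    then have "norm (\<theta> - \<theta>s) \<le> s" "\<Psi> (\<theta> - \<theta>s) \<le> \<rho>"
      by (auto simp: dist_norm norm_minus_commute norm_ball_def)
    then have "max (norm (\<theta> - \<theta>s)) (s * \<Psi> (\<theta> - \<theta>s) / \<rho>) \<le> s"
      using assms(3,4) by (simp add: field_simps)
    then have "L * s * max (norm (\<theta> - \<theta>s)) (s * \<Psi> (\<theta> - \<theta>s) / \<rho>) \<le> L * s * s"
      using assms(3,5) by (intro mult_left_mono) auto
    then show "\<bar>m (\<theta> - \<theta>s)\<bar> \<le> L * s\<^sup>2"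
      using B[rule_format, of "\<theta> - \<theta>s"] by (simp add: power2_eq_square mult.assoc)
  qed
qed

lemma ball_bound_mono:
  assumes "0 \<le> L" "0 \<le> s" "s \<le> t" "0 < \<rho>" "(0::real) \<le> b"
  shows "L * s * max a (s * b / \<rho>) \<le> L * t * max a (t * b / \<rho>)"
proof -
  have "s * b / \<rho> \<le> t * b / \<rho>" using assms by (intro divide_right_mono mult_right_mono) auto
  moreover have "0 \<le> s * b / \<rho>" using assms by auto
  ultimately show ?thesis using assms by (intro mult_mono) (auto simp: le_max_iff_disj)
qed

text \<open>If the inequality failed in the limit, continuity would make it fail for all large
  \<open>n\<close>. Infinitely many valid \<open>n\<close> therefore suffice, which is all that a
  limsup of events provides.\<close>

lemma bound_at_limit:
  fixes x :: real
  assumes "\<exists>\<^sub>\<infinity>n. x \<le> L * s n * max a (s n * b / \<rho>)" "s \<longlonglongrightarrow> r" "0 < \<rho>"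
  shows "x \<le> L * r * max a (r * b / \<rho>)"
proof (rule ccontr)
  assume "\<not> ?thesis"
  moreover have "(\<lambda>n. L * s n * max a (s n * b / \<rho>)) \<longlonglongrightarrow> L * r * max a (r * b / \<rho>)"
    using assms(3) by (intro tendsto_intros assms(2)) auto
  ultimately have "\<forall>\<^sub>F n in sequentially. L * s n * max a (s n * b / \<rho>) < x"
    by (intro order_tendstoD(2)) auto
  then have "\<forall>\<^sub>\<infinity>n. L * s n * max a (s n * b / \<rho>) < x"
    by (simp add: cofinite_eq_sequentially)
  with assms(1) show False
    by (smt (verit, ccfv_SIG) INFM_E INFM_conjI)
qed

text \<open>The inequality \<open>r * \<Psi> v < \<rho> * norm v\<close> is strict because a point of the sphere of radius \<open>r\<close> with
  \<open>\<Psi> v = \<rho>\<close> need not be a limit of points of larger spheres inside the \<open>\<Psi>\<close>-ball.  Such points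
  fall under the case in which the ray leaves through the \<open>\<Psi>\<close>-sphere.\<close>

lemma quadratic_bound_at_limit:
  fixes Q :: "real ^ 'd \<Rightarrow> real"
  assumes "is_norm \<Psi>" "0 < L" "0 < \<rho>"
    and s: "\<And>n. 0 < s n" "\<And>n. r \<le> s n" "s \<longlonglongrightarrow> r"
    and scale: "\<And>t v. 1 \<le> t \<Longrightarrow> t * Q v \<le> Q (t *\<^sub>R v)"
    and bound: "\<exists>\<^sub>\<infinity>n. \<forall>\<theta>\<in>sphere \<theta>s (s n) \<inter> norm_ball \<Psi> \<theta>s \<rho>. L * (s n)\<^sup>2 \<le> Q (\<theta> - \<theta>s)"
    and v: "r < norm v" "r * \<Psi> v < \<rho> * norm v"
  shows "L * r * norm v \<le> Q v" and "0 < Q v"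
proof -
  \<comment> \<open>Both strict inequalities at \<open>r\<close> persist at \<open>s n\<close> for
    large \<open>n\<close>, so some \<open>n\<close> combines them with the sphere bound.\<close>
  have "\<forall>\<^sub>F n in sequentially. s n < norm v \<and> s n * \<Psi> v < \<rho> * norm v"
    using order_tendstoD(2)[OF s(3) v(1)]
      order_tendstoD(2)[OF tendsto_mult_right[OF s(3), of "\<Psi> v"] v(2)]
    by eventually_elim simp
  then have "\<forall>\<^sub>\<infinity>n. s n < norm v \<and> s n * \<Psi> v < \<rho> * norm v"
    by (simp add: cofinite_eq_sequentially)
  from INFM_conjI[OF bound this] obtain n
    where n: "\<forall>\<theta>\<in>sphere \<theta>s (s n) \<inter> norm_ball \<Psi> \<theta>s \<rho>. L * (s n)\<^sup>2 \<le> Q (\<theta> - \<theta>s)"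
      "s n < norm v" "s n * \<Psi> v < \<rho> * norm v"
    by (auto dest!: INFM_EX)
  have v0: "0 < norm v" using n(2) s(1)[of n] by linarith
  \<comment> \<open>\<open>?w\<close> is the point where the ray through \<open>v\<close> crosses
    the sphere of radius \<open>s n\<close>; \<open>scale\<close> then carries the bound from
    \<open>?w\<close> out to \<open>v\<close>.\<close>
  let ?w = "(s n / norm v) *\<^sub>R v"
  have "\<theta>s + ?w \<in> sphere \<theta>s (s n) \<inter> norm_ball \<Psi> \<theta>s \<rho>"
    using v0 s(1)[of n] n by (auto simp: dist_norm norm_ball_def is_norm_scale[OF assms(1)] field_simps)
  from n(1)[rule_format, OF this] have "L * (s n)\<^sup>2 \<le> Q ?w" by simp
  then have "norm v / s n * (L * (s n)\<^sup>2) \<le> norm v / s n * Q ?w"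
    using v0 s(1)[of n] by (intro mult_left_mono) auto
  also have "\<dots> \<le> Q ((norm v / s n) *\<^sub>R ?w)"
    using n(2) s(1)[of n] by (intro scale) auto
  also have "(norm v / s n) *\<^sub>R ?w = v" using v0 s(1)[of n] by simp
  finally have *: "L * s n * norm v \<le> Q v"
    using s(1)[of n] by (simp add: power2_eq_square field_simps)
  \<comment> \<open>Positivity comes from the positive level \<open>s n\<close>, because the bound
    \<open>L * r * norm v\<close> is 0 when \<open>r = 0\<close>.\<close>
  show "0 < Q v" using * v0 s(1)[of n] assms(2) by (smt (verit) mult_pos_pos)
  have "L * r * norm v \<le> L * s n * norm v"
    using s(2)[of n] assms(2) by (intro mult_right_mono mult_left_mono) auto
  with * show "L * r * norm v \<le> Q v" by linarith
qed

text \<open>Subgradients are taken at points \<open>u\<close> near \<open>\<theta>s\<close>, not at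
  \<open>\<theta>s\<close> itself. Replacing \<open>u\<close> by \<open>\<theta>s\<close> costs
  \<open>\<rho> / 4\<close> in the inner product and \<open>\<rho> / 4\<close> in the value of
  \<open>\<Psi>\<close>, which leaves \<open>\<rho> / 4\<close> of the assumed
  \<open>3/4 * \<rho>\<close>.\<close>

lemma sparsity_increment:
  fixes \<Psi> :: "real ^ 'd \<Rightarrow> real"
  assumes "is_norm \<Psi>" "0 < \<rho>" "sparsity_Delta \<Psi> \<theta>s r \<rho> \<ge> ereal (3/4 * \<rho>)"
    and v: "norm v \<le> r" "\<Psi> v = \<rho>"
  shows "\<rho> / 4 \<le> \<Psi> (\<theta>s + v) - \<Psi> \<theta>s"
proof -
  have "\<theta>s + v \<in> cball \<theta>s r \<inter> norm_sphere \<Psi> \<theta>s \<rho>"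
    using v by (auto simp: dist_norm norm_sphere_def)
  then have "ereal (3/4 * \<rho>) \<le> (SUP z \<in> subgradients \<Psi> \<theta>s \<rho>. ereal (z \<bullet> (\<theta>s + v - \<theta>s)))"
    using assms(3) unfolding sparsity_Delta_def by (meson INF_lower order_trans)
  also have "\<dots> \<le> ereal (\<Psi> (\<theta>s + v) - \<Psi> \<theta>s + \<rho> / 2)"
  proof (rule SUP_least)
    fix z assume "z \<in> subgradients \<Psi> \<theta>s \<rho>"
    then obtain u where u: "\<Psi> (u - \<theta>s) \<le> \<rho> / 4" "\<And>h. z \<bullet> h \<le> \<Psi> (u + h) - \<Psi> u"
      by (auto simp: subgradients_def norm_ball_def)
    \<comment> \<open>The subgradient inequality in direction \<open>u - \<theta>s\<close> together
      with the triangle inequality shows that \<open>z\<close> is dominated by \<open>\<Psi>\<close>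
      in this direction.\<close>
    have "z \<bullet> (u - \<theta>s) \<le> \<rho> / 4"
      using u(2)[of "u - \<theta>s"] is_norm_triangle[OF assms(1), of u "u - \<theta>s"] u(1) by linarith
    moreover have "z \<bullet> (\<theta>s - u + v) \<le> \<Psi> (\<theta>s + v) - \<Psi> u"
      using u(2)[of "\<theta>s - u + v"] by (simp add: algebra_simps)
    moreover have "\<Psi> \<theta>s - \<Psi> u \<le> \<rho> / 4"
      using is_norm_increment_ge[OF assms(1), of "u - \<theta>s" \<theta>s] u(1) by simp
    ultimately show "ereal (z \<bullet> (\<theta>s + v - \<theta>s)) \<le> ereal (\<Psi> (\<theta>s + v) - \<Psi> \<theta>s + \<rho> / 2)"
      by (simp add: inner_diff_right inner_add_right)
  qed
  finally show ?thesis by simp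
qed

text \<open>\<open>Q\<close> and \<open>m\<close> stand for the values at \<open>v\<close> of the
  quadratic and the linear part. The condition \<open>r * \<Psi> v < \<rho> * norm v\<close> says
  that the ray through \<open>v\<close> leaves through the Euclidean sphere. Then \<open>Q\<close>
  beats the linear part and the possible decrease of the penalty, using
  \<open>\<kappa> + c2 < L\<close>; otherwise the increase of the penalty beats the linear part,
  using \<open>8 * \<kappa> \<le> c1\<close>.\<close>

lemma excess_pos_outside:
  fixes \<Psi> :: "real ^ 'd \<Rightarrow> real"
  assumes "is_norm \<Psi>" "0 < \<rho>" "0 \<le> r" "0 < \<kappa>"
    and Q: "0 \<le> Q" "r < norm v \<Longrightarrow> r * \<Psi> v < \<rho> * norm v \<Longrightarrow> L * r * norm v \<le> Q \<and> 0 < Q"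
    and m: "\<bar>m\<bar> \<le> \<kappa> * r * max (norm v) (r * \<Psi> v / \<rho>)"
    and lam: "c1 * (r\<^sup>2 / \<rho>) \<le> lam" "lam \<le> c2 * (r\<^sup>2 / \<rho>)" "8 * \<kappa> \<le> c1" "\<kappa> + c2 < L"
    and sparse: "sparsity_Delta \<Psi> \<theta>s r \<rho> \<ge> ereal (3/4 * \<rho>)"
    and v: "r < norm v \<or> \<rho> < \<Psi> v"
  shows "0 < Q - m + lam * (\<Psi> (\<theta>s + v) - \<Psi> \<theta>s)"
proof -
  have v0: "v \<noteq> 0" using v assms(2,3) is_norm_eq_0[OF assms(1), of 0] by auto
  have \<Psi>v: "0 \<le> \<Psi> v" by (rule is_norm_nonneg[OF assms(1)])
  have lam0: "0 \<le> lam" using lam assms(2,4) by (smt (verit) divide_nonneg_pos mult_nonneg_nonneg zero_le_power2)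
  show ?thesis
  proof (cases "r * \<Psi> v < \<rho> * norm v")
    case True
    have "r < norm v"
    proof (cases "r = 0")
      case False
      then show ?thesis using v True assms(2,3)
        by (smt (verit) mult.commute mult_less_cancel_left_pos mult_mono)
    qed (use v0 in auto)
    with Q(2) True have Q': "L * r * norm v \<le> Q" "0 < Q" by auto
    have "r * \<Psi> v / \<rho> \<le> norm v" using True assms(2) by (simp add: field_simps)
    then have m': "m \<le> \<kappa> * r * norm v" using m by (simp add: max_def split: if_splits)
    have p: "lam * - \<Psi> v \<le> lam * (\<Psi> (\<theta>s + v) - \<Psi> \<theta>s)"
      by (intro mult_left_mono is_norm_increment_ge[OF assms(1)] lam0)
    show ?thesis
    proof (cases "r = 0")
      \<comment> \<open>With \<open>r = 0\<close> the two-sided bound forces \<open>lam = 0\<close>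
        and the linear part is at most 0, so the strict positivity of \<open>Q\<close>
        decides.\<close>
      case True
      then have "lam = 0" using lam0 lam(2) by simp
      then show ?thesis using m' Q'(2) True by simp
    next
      case False
      then have r: "0 < r" using assms(3) by simp
      \<comment> \<open>The interval for \<open>lam\<close> is nonempty, so
        \<open>c1 \<le> c2\<close>. Positivity lets \<open>r * \<Psi> v / \<rho>\<close> be replaced
        by \<open>norm v\<close> below.\<close>
      have "0 < c2"
      proof (rule ccontr)
        assume "\<not> 0 < c2"
        moreover have "c1 * (r\<^sup>2 / \<rho>) \<le> c2 * (r\<^sup>2 / \<rho>)" using lam by linarith
        then have "c1 \<le> c2" by (rule mult_right_le_imp_le) (use r assms(2) in simp)
        ultimately show False using lam(3) assms(4) by linarith
      qed
      have "lam * \<Psi> v \<le> c2 * (r\<^sup>2 / \<rho>) * \<Psi> v" using lam(2) \<Psi>v by (rule mult_right_mono)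
      also have "\<dots> = c2 * r * (r * \<Psi> v / \<rho>)" by (simp add: power2_eq_square)
      also have "\<dots> \<le> c2 * r * norm v"
        using \<open>r * \<Psi> v / \<rho> \<le> norm v\<close> \<open>0 < c2\<close> r by (intro mult_left_mono) auto
      finally have "(L - \<kappa> - c2) * (r * norm v) \<le> Q - m + lam * (\<Psi> (\<theta>s + v) - \<Psi> \<theta>s)"
        using Q'(1) m' p by (simp add: algebra_simps)
      moreover have "0 < (L - \<kappa> - c2) * (r * norm v)" using lam(4) r v0 by simp
      ultimately show ?thesis by linarith
    qed
  next
    case False
    then have *: "\<rho> * norm v \<le> r * \<Psi> v" by simp
    have r: "0 < r" using * v0 assms(2,3) by (cases "r = 0") (auto simp: mult_le_0_iff)
    have \<rho>: "\<rho> \<le> \<Psi> v"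
      using v * r assms(2) by (smt (verit) mult.commute mult_less_cancel_left_pos)
    \<comment> \<open>Dividing \<open>v\<close> by \<open>?t\<close> gives the point where the ray
      meets the \<open>\<Psi>\<close>-sphere. It still lies in the Euclidean ball, so the sparsity
      bound applies there, and convexity of \<open>\<Psi>\<close> transports it to
      \<open>v\<close>.\<close>
    let ?t = "\<Psi> v / \<rho>"
    have t: "1 \<le> ?t" using \<rho> assms(2) by simp
    have "norm ((1 / ?t) *\<^sub>R v) \<le> r" using * \<rho> assms(2) by (simp add: field_simps)
    moreover have "\<Psi> ((1 / ?t) *\<^sub>R v) = \<rho>"
      using \<rho> assms(2) by (simp add: is_norm_scale[OF assms(1)])
    ultimately have "\<rho> / 4 \<le> \<Psi> (\<theta>s + (1 / ?t) *\<^sub>R v) - \<Psi> \<theta>s"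
      by (rule sparsity_increment[OF assms(1,2) sparse])
    then have "?t * (\<rho> / 4) \<le> ?t * (\<Psi> (\<theta>s + (1 / ?t) *\<^sub>R v) - \<Psi> \<theta>s)"
      using t by (intro mult_left_mono) auto
    also have "\<dots> \<le> \<Psi> (\<theta>s + ?t *\<^sub>R ((1 / ?t) *\<^sub>R v)) - \<Psi> \<theta>s"
      by (rule convex_on_scale_increment[OF is_norm_convex[OF assms(1)] t])
    also have "?t *\<^sub>R ((1 / ?t) *\<^sub>R v) = v" using t by auto
    finally have "\<Psi> v / 4 \<le> \<Psi> (\<theta>s + v) - \<Psi> \<theta>s" using assms(2) by simp
    then have p: "lam * (\<Psi> v / 4) \<le> lam * (\<Psi> (\<theta>s + v) - \<Psi> \<theta>s)"
      using lam0 by (rule mult_left_mono)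
    \<comment> \<open>The factor 8 times the quarter from sparsity gives twice the bound on
      \<open>m\<close>; the surplus makes the conclusion strict.\<close>
    have "8 * \<kappa> * (r\<^sup>2 / \<rho>) \<le> c1 * (r\<^sup>2 / \<rho>)"
      using lam(3) assms(2) by (intro mult_right_mono) auto
    then have "8 * \<kappa> * (r\<^sup>2 / \<rho>) * (\<Psi> v / 4) \<le> lam * (\<Psi> v / 4)"
      using lam(1) \<Psi>v by (intro mult_right_mono) auto
    then have sc: "2 * (\<kappa> * (r\<^sup>2 / \<rho>) * \<Psi> v) \<le> lam * (\<Psi> v / 4)"
      by (simp add: mult_ac)
    have "norm v \<le> r * \<Psi> v / \<rho>" using * assms(2) by (simp add: field_simps)
    then have m': "m \<le> \<kappa> * (r\<^sup>2 / \<rho>) * \<Psi> v"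
      using m by (simp add: max_def power2_eq_square split: if_splits)
    have gap: "0 < \<kappa> * (r\<^sup>2 / \<rho>) * \<Psi> v" using r \<rho> assms(2,4) by simp
    have "m < 2 * (\<kappa> * (r\<^sup>2 / \<rho>) * \<Psi> v)" using m' gap by simp
    also note sc
    also note p
    finally show ?thesis using Q(1) by linarith
  qed
qed

text \<open>The case split is that of \<open>excess_pos_outside\<close>. A ray leaving through the
  \<open>\<Psi>\<close>-sphere contradicts \<open>nonpos\<close>, since
  \<open>4 * \<Psi> \<theta>s \<le> \<rho>\<close> takes over the role of sparsity. On a ray leaving
  through the Euclidean sphere, \<open>nonpos\<close> bounds \<open>norm v\<close>.\<close>

lemma excess_nonpos_bound:
  fixes \<Psi> :: "real ^ 'd \<Rightarrow> real"
  assumes "is_norm \<Psi>" "0 < \<rho>" "0 \<le> r" "0 < \<kappa>"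
    and Q: "0 \<le> Q" "r < norm v \<Longrightarrow> r * \<Psi> v < \<rho> * norm v \<Longrightarrow> L * r * norm v \<le> Q \<and> 0 < Q"
    and m: "\<bar>m\<bar> \<le> \<kappa> * r * max (norm v) (r * \<Psi> v / \<rho>)"
    and lam: "c1 * (r\<^sup>2 / \<rho>) \<le> lam" "8 * \<kappa> < c1" "\<kappa> < L"
    and k: "\<rho> = k * \<Psi> \<theta>s" "4 < k"
    and nonpos: "Q - m + lam * (\<Psi> (\<theta>s + v) - \<Psi> \<theta>s) \<le> 0"
  shows "ereal (norm v) \<le> max (ereal r) (ereal lam / ereal (r * (L - \<kappa>)) * ereal (\<Psi> \<theta>s))"
proof (cases "r < norm v")
  case outside: True
  have \<Psi>v: "0 \<le> \<Psi> v" by (rule is_norm_nonneg[OF assms(1)])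
  have \<Psi>\<theta>: "0 < \<Psi> \<theta>s" using k assms(2) by (simp add: zero_less_mult_iff)
  have lam0: "0 \<le> lam" using lam assms(2,4) by (smt (verit) divide_nonneg_pos mult_nonneg_nonneg zero_le_power2)
  have v0: "0 < norm v" using outside assms(3) by linarith
  show ?thesis
  proof (cases "r * \<Psi> v < \<rho> * norm v")
    case True
    with Q(2) outside have Q': "L * r * norm v \<le> Q" "0 < Q" by auto
    have "r * \<Psi> v / \<rho> \<le> norm v" using True assms(2) by (simp add: field_simps)
    then have m': "m \<le> \<kappa> * r * norm v" using m by (simp add: max_def split: if_splits)
    show ?thesis
    proof (cases "r = 0")
      case True
      \<comment> \<open>At \<open>r = 0\<close> the linear part is at most 0 while \<open>Q\<close>
        is positive, so \<open>lam = 0\<close> would contradict \<open>nonpos\<close>. With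
        \<open>lam\<close> positive the extended-real quotient is infinite and the claim is
        trivial.\<close>
      have "lam \<noteq> 0" using nonpos Q'(2) m' True by auto
      then have "ereal lam / ereal (r * (L - \<kappa>)) * ereal (\<Psi> \<theta>s) = \<infinity>"
        using True lam0 \<Psi>\<theta> by (simp add: divide_ereal_def zero_ereal_def[symmetric])
      then show ?thesis by (simp only: max_def ereal_less_eq if_True)
    next
      case False
      then have r: "0 < r" using assms(3) by simp
      \<comment> \<open>No upper bound on \<open>lam\<close> is available here, so the decrease of
        the penalty is bounded by \<open>\<Psi> \<theta>s\<close>, from nonnegativity of
        \<open>\<Psi>\<close>, and not by \<open>\<Psi> v\<close>.\<close>
      have "lam * - \<Psi> \<theta>s \<le> lam * (\<Psi> (\<theta>s + v) - \<Psi> \<theta>s)"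
        using lam0 is_norm_nonneg[OF assms(1), of "\<theta>s + v"] by (intro mult_left_mono) auto
      then have "(L - \<kappa>) * r * norm v \<le> lam * \<Psi> \<theta>s"
        using nonpos Q'(1) m' by (simp add: algebra_simps)
      then have "norm v \<le> lam / (r * (L - \<kappa>)) * \<Psi> \<theta>s"
        using r lam(3) by (simp add: field_simps)
      moreover have "ereal lam / ereal (r * (L - \<kappa>)) = ereal (lam / (r * (L - \<kappa>)))"
        using r lam(3) by simp
      ultimately show ?thesis by (simp only: le_max_iff_disj times_ereal.simps ereal_less_eq simp_thms)
    qed
  next
    case False
    then have *: "\<rho> * norm v \<le> r * \<Psi> v" by simp
    have r: "0 < r" using * v0 assms(2,3) by (cases "r = 0") (auto simp: mult_le_0_iff)
    have \<rho>: "\<rho> \<le> \<Psi> v"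
      using outside * r assms(2) by (smt (verit) mult.commute mult_less_cancel_left_pos)
    \<comment> \<open>The increment is at least \<open>\<Psi> v - 2 * \<Psi> \<theta>s\<close>, and
      \<open>2 * \<Psi> \<theta>s\<close> is at most half of \<open>\<rho>\<close>, hence of
      \<open>\<Psi> v\<close>.\<close>
    have "4 * \<Psi> \<theta>s \<le> \<rho>" using k \<Psi>\<theta> by simp
    moreover have "\<Psi> v \<le> \<Psi> (\<theta>s + v) + \<Psi> \<theta>s"
      using is_norm_triangle[OF assms(1), of "\<theta>s + v" "- \<theta>s"] is_norm_minus[OF assms(1)] by simp
    ultimately have "\<Psi> v / 2 \<le> \<Psi> (\<theta>s + v) - \<Psi> \<theta>s" using \<rho> by linarith
    then have p: "lam * (\<Psi> v / 2) \<le> lam * (\<Psi> (\<theta>s + v) - \<Psi> \<theta>s)"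
      using lam0 by (rule mult_left_mono)
    have "8 * \<kappa> * (r\<^sup>2 / \<rho>) \<le> c1 * (r\<^sup>2 / \<rho>)"
      using lam(2) assms(2) by (intro mult_right_mono) auto
    then have "8 * \<kappa> * (r\<^sup>2 / \<rho>) * (\<Psi> v / 2) \<le> lam * (\<Psi> v / 2)"
      using lam(1) \<Psi>v by (intro mult_right_mono) auto
    then have sc: "4 * (\<kappa> * (r\<^sup>2 / \<rho>) * \<Psi> v) \<le> lam * (\<Psi> v / 2)"
      by (simp add: mult_ac)
    have "norm v \<le> r * \<Psi> v / \<rho>" using * assms(2) by (simp add: field_simps)
    then have m': "m \<le> \<kappa> * (r\<^sup>2 / \<rho>) * \<Psi> v"
      using m by (simp add: max_def power2_eq_square split: if_splits)
    have gap: "0 < \<kappa> * (r\<^sup>2 / \<rho>) * \<Psi> v" using r \<rho> assms(2,4) by simp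
    have "m < 4 * (\<kappa> * (r\<^sup>2 / \<rho>) * \<Psi> v)" using m' gap by simp
    also note sc
    also note p
    finally show ?thesis using Q(1) nonpos by linarith
  qed
qed (simp add: le_max_iff_disj)

section \<open>Measurability and limits of events\<close>

text \<open>The limsup is the decreasing intersection of the tail unions. Each of them contains some
  \<open>E n\<close>, hence has probability at least \<open>q\<close>, and continuity from above
  concludes.\<close>

lemma prob_frequently_ge:
  fixes E :: "nat \<Rightarrow> 'a set"
  assumes "prob_space M" "\<And>n. E n \<in> sets M" "\<And>n. q \<le> measure M (E n)"
  shows "{\<omega> \<in> space M. \<exists>\<^sub>\<infinity>n. \<omega> \<in> E n} \<in> sets M"
    and "q \<le> measure M {\<omega> \<in> space M. \<exists>\<^sub>\<infinity>n. \<omega> \<in> E n}"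
proof -
  interpret prob_space M by fact
  let ?U = "\<lambda>n. \<Union>m\<in>{n..}. E m"
  have U: "?U n \<in> sets M" for n using assms(2) by auto
  have eq: "{\<omega> \<in> space M. \<exists>\<^sub>\<infinity>n. \<omega> \<in> E n} = (\<Inter>n. ?U n)"
    using sets.sets_into_space[OF assms(2)] by (fastforce simp: INFM_nat_le)
  show "{\<omega> \<in> space M. \<exists>\<^sub>\<infinity>n. \<omega> \<in> E n} \<in> sets M"
    unfolding eq using U by (intro sets.countable_INT) auto
  have "(\<lambda>n. prob (?U n)) \<longlonglongrightarrow> prob (\<Inter>n. ?U n)"
    using U by (intro finite_Lim_measure_decseq) (fastforce simp: decseq_def)+
  moreover have "q \<le> prob (?U n)" for n
    using assms(3)[of n] by (rule order_trans) (intro finite_measure_mono U, auto)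
  ultimately show "q \<le> prob {\<omega> \<in> space M. \<exists>\<^sub>\<infinity>n. \<omega> \<in> E n}"
    unfolding eq by (intro LIMSEQ_le_const) auto
qed

section \<open>Measurability of events quantified over uncountably many parameters\<close>

lemma nonneg_on_closure:
  fixes f :: "'v::metric_space \<Rightarrow> real"
  assumes "continuous_on S f" "T \<subseteq> S" "S \<subseteq> closure T" "\<And>v. v \<in> T \<Longrightarrow> 0 \<le> f v" "v \<in> S"
  shows "0 \<le> f v"
proof -
  from assms(3,5) obtain x where x: "\<And>n. x n \<in> T" "x \<longlonglongrightarrow> v"
    by (meson closure_sequential subsetD)
  have "(\<lambda>n. f (x n)) \<longlonglongrightarrow> f v"
    using assms(1,2,5) x unfolding continuous_on_sequentially by (auto simp: o_def)
  then show ?thesis by (rule LIMSEQ_le_const) (use assms(4) x(1) in auto)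
qed

text \<open>Continuity in the parameter reduces the quantifier to a countable dense subset of
  \<open>S\<close>.\<close>

lemma sets_all_nonneg:
  fixes f :: "'v::{metric_space, second_countable_topology} \<Rightarrow> 'a \<Rightarrow> real"
  assumes "\<And>\<omega>. continuous_on S (\<lambda>v. f v \<omega>)" and f: "\<And>v. f v \<in> borel_measurable M"
  shows "{\<omega> \<in> space M. \<forall>v\<in>S. 0 \<le> f v \<omega>} \<in> sets M"
proof -
  obtain T where T: "countable T" "T \<subseteq> S" "S \<subseteq> closure T" using separable by blast
  have "{\<omega> \<in> space M. \<forall>v\<in>S. 0 \<le> f v \<omega>} = {\<omega> \<in> space M. \<forall>v\<in>T. 0 \<le> f v \<omega>}"
    using T(2) nonneg_on_closure[OF assms(1) T(2,3)] by blast
  also have "\<dots> \<in> sets M" using T(1) f by measurable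
  finally show ?thesis .
qed

text \<open>Strict inequalities do not pass to closures, but on a compact set the minimum is
  attained. Positivity is therefore uniform, with a margin \<open>inverse (real (Suc n))\<close>,
  and the weak case applies.\<close>

lemma sets_all_pos_compact:
  fixes f :: "'v::{metric_space, second_countable_topology} \<Rightarrow> 'a \<Rightarrow> real"
  assumes "compact K" and cont: "\<And>\<omega>. continuous_on K (\<lambda>v. f v \<omega>)"
    and f: "\<And>v. f v \<in> borel_measurable M"
  shows "{\<omega> \<in> space M. \<forall>v\<in>K. 0 < f v \<omega>} \<in> sets M"
proof -
  have *: "(\<forall>v\<in>K. 0 < f v \<omega>) \<longleftrightarrow> (\<exists>n. \<forall>v\<in>K. 0 \<le> f v \<omega> - inverse (real (Suc n)))" for \<omega>
  proof (intro iffI)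
    assume pos: "\<forall>v\<in>K. 0 < f v \<omega>"
    show "\<exists>n. \<forall>v\<in>K. 0 \<le> f v \<omega> - inverse (real (Suc n))"
    proof (cases "K = {}")
      case False
      then obtain u where u: "u \<in> K" "\<forall>v\<in>K. f u \<omega> \<le> f v \<omega>"
        using continuous_attains_inf[OF assms(1) _ cont] by blast
      then obtain n where "inverse (real (Suc n)) < f u \<omega>" using pos reals_Archimedean by blast
      then show ?thesis using u(2) by (intro exI[of _ n]) (auto intro: less_imp_le less_le_trans)
    qed auto
  next
    assume "\<exists>n. \<forall>v\<in>K. 0 \<le> f v \<omega> - inverse (real (Suc n))"
    then obtain n where "\<forall>v\<in>K. inverse (real (Suc n)) \<le> f v \<omega>" by auto
    moreover have "0 < inverse (real (Suc n))" by simp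
    ultimately show "\<forall>v\<in>K. 0 < f v \<omega>" by (meson less_le_trans)
  qed
  have "{\<omega> \<in> space M. \<forall>v\<in>K. 0 \<le> f v \<omega> - inverse (real (Suc n))} \<in> sets M" for n
    by (intro sets_all_nonneg continuous_intros cont borel_measurable_diff f) auto
  then show ?thesis unfolding * by (rule sets.sets_Collect_countable_Ex)
qed

lemma sets_all_pos_open:
  fixes f :: "'v::euclidean_space \<Rightarrow> 'a \<Rightarrow> real"
  assumes "open U" and cont: "\<And>\<omega>. continuous_on U (\<lambda>v. f v \<omega>)"
    and f: "\<And>v. f v \<in> borel_measurable M"
  shows "{\<omega> \<in> space M. \<forall>v\<in>U. 0 < f v \<omega>} \<in> sets M"
proof -
  obtain K where K: "\<And>n::nat. compact (K n)" "\<And>n. K n \<subseteq> U" "\<Union>(range K) = U"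
    using open_Union_compact_subsets[OF assms(1)] by metis
  have "{\<omega> \<in> space M. \<forall>v\<in>K n. 0 < f v \<omega>} \<in> sets M" for n
    by (intro sets_all_pos_compact K f continuous_on_subset[OF cont])
  then have "{\<omega> \<in> space M. \<forall>n. \<forall>v\<in>K n. 0 < f v \<omega>} \<in> sets M" by (rule sets.sets_Collect_countable_All)
  moreover have "(\<forall>v\<in>U. 0 < f v \<omega>) \<longleftrightarrow> (\<forall>n. \<forall>v\<in>K n. 0 < f v \<omega>)" for \<omega>
    using K(3) by blast
  ultimately show ?thesis by simp
qed

text \<open>Minimizers may be absent or not unique, so no measurable selection is used. The
  complement of \<open>C\<close> is exhausted by compact sets \<open>K n\<close>, and no minimizer
  lies in \<open>K n\<close> exactly when a single \<open>q\<close> of a countable dense set has a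
  value below all values on \<open>K n\<close>.\<close>

lemma sets_all_minimizers_in_closed:
  fixes f :: "'v::euclidean_space \<Rightarrow> 'a \<Rightarrow> real"
  assumes "closed C" and cont: "\<And>\<omega>. continuous_on UNIV (\<lambda>v. f v \<omega>)"
    and f: "\<And>v. f v \<in> borel_measurable M"
  shows "{\<omega> \<in> space M. \<forall>\<theta>. (\<forall>\<eta>. f \<theta> \<omega> \<le> f \<eta> \<omega>) \<longrightarrow> \<theta> \<in> C} \<in> sets M"
proof -
  obtain K where K: "\<And>n::nat. compact (K n)" "\<And>n. K n \<subseteq> - C" "\<Union>(range K) = - C"
    using open_Union_compact_subsets[of "- C"] assms(1) by (metis open_Compl)
  obtain T :: "'v set" where T: "countable T" "UNIV \<subseteq> closure T" using separable by blast
  then have "T \<noteq> {}" by auto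
  have *: "(\<forall>\<theta>. (\<forall>\<eta>. f \<theta> \<omega> \<le> f \<eta> \<omega>) \<longrightarrow> \<theta> \<in> C) \<longleftrightarrow> (\<forall>n. \<exists>q\<in>T. \<forall>\<theta>\<in>K n. 0 < f \<theta> \<omega> - f q \<omega>)" for \<omega>
  proof (intro iffI allI impI)
    fix n assume C: "\<forall>\<theta>. (\<forall>\<eta>. f \<theta> \<omega> \<le> f \<eta> \<omega>) \<longrightarrow> \<theta> \<in> C"
    show "\<exists>q\<in>T. \<forall>\<theta>\<in>K n. 0 < f \<theta> \<omega> - f q \<omega>"
    proof (rule ccontr)
      assume "\<not> ?thesis"
      then have le: "\<exists>\<theta>\<in>K n. f \<theta> \<omega> \<le> f q \<omega>" if "q \<in> T" for q
        using that by (auto simp: not_less)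
      then have "K n \<noteq> {}" using \<open>T \<noteq> {}\<close> by blast
      then obtain u where u: "u \<in> K n" "\<forall>v\<in>K n. f u \<omega> \<le> f v \<omega>"
        using continuous_attains_inf[OF K(1)] cont continuous_on_subset by (metis subset_UNIV)
      \<comment> \<open>If no \<open>q\<close> in \<open>T\<close> beats all of \<open>K n\<close>,
        the minimum over \<open>K n\<close> is at most every value on \<open>T\<close>. By density
        \<open>u\<close> is then a global minimizer outside \<open>C\<close>.\<close>
      have "0 \<le> f \<eta> \<omega> - f u \<omega>" for \<eta>
      proof (rule nonneg_on_closure[where f = "\<lambda>\<eta>. f \<eta> \<omega> - f u \<omega>", OF _ subset_UNIV T(2) _ UNIV_I])
        show "continuous_on UNIV (\<lambda>\<eta>. f \<eta> \<omega> - f u \<omega>)" by (intro continuous_intros cont)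
        show "0 \<le> f q \<omega> - f u \<omega>" if "q \<in> T" for q using le[OF that] u(2) by force
      qed
      then show False using C u(1) K(2) by fastforce
    qed
  next
    fix \<theta> assume pos: "\<forall>n. \<exists>q\<in>T. \<forall>\<theta>\<in>K n. 0 < f \<theta> \<omega> - f q \<omega>" and le: "\<forall>\<eta>. f \<theta> \<omega> \<le> f \<eta> \<omega>"
    show "\<theta> \<in> C"
    proof (rule ccontr)
      assume "\<theta> \<notin> C"
      then obtain n where "\<theta> \<in> K n" using K(3) by blast
      then obtain q where "0 < f \<theta> \<omega> - f q \<omega>" using pos by blast
      then show False using le[rule_format, of q] by simp
    qed
  qed
  have "{\<omega> \<in> space M. \<forall>\<theta>\<in>K n. 0 < f \<theta> \<omega> - f q \<omega>} \<in> sets M" for n q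
    by (intro sets_all_pos_compact K continuous_intros continuous_on_subset[OF cont] borel_measurable_diff f) auto
  then show ?thesis unfolding *
    by (intro sets.sets_Collect_countable_All sets.sets_Collect_countable_Ex' T)
qed

text \<open>Clipping by \<open>max\<close> and \<open>min\<close> makes continuity visible, which
  the form with \<open>sgn\<close> hides.\<close>

lemma truncated_clip: "truncated N x = (\<chi> j. max (- trunc_level N CARD('d)) (min (x $ j) (trunc_level N CARD('d))))"
  for x :: "real ^ 'd"
proof -
  have "0 \<le> trunc_level N CARD('d)" by (simp add: trunc_level_def)
  then show ?thesis by (auto simp: truncated_def vec_eq_iff sgn_if min_def max_def)
qed

lemma continuous_on_truncated [continuous_intros]:
  "continuous_on S f \<Longrightarrow> continuous_on S (\<lambda>x. truncated N (f x))"
  unfolding truncated_clip by (intro continuous_intros)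

lemma emp_avg_add: "emp_avg N Z (\<lambda>z. f z + h z) \<omega> = emp_avg N Z f \<omega> + emp_avg N Z h \<omega>"
  and emp_avg_diff: "emp_avg N Z (\<lambda>z. f z - h z) \<omega> = emp_avg N Z f \<omega> - emp_avg N Z h \<omega>"
  and emp_avg_mult: "emp_avg N Z (\<lambda>z. a * f z) \<omega> = a * emp_avg N Z f \<omega>"
  by (simp_all add: emp_avg_def sum.distrib sum_subtractf sum_distrib_left add_divide_distrib diff_divide_distrib)

lemma emp_avg_const: "0 < N \<Longrightarrow> emp_avg N Z (\<lambda>z. a) \<omega> = a"
  by (simp add: emp_avg_def)

lemma emp_avg_mono: "(\<And>z. f z \<le> h z) \<Longrightarrow> emp_avg N Z f \<omega> \<le> emp_avg N Z h \<omega>"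
  by (simp add: emp_avg_def divide_right_mono sum_mono)

section \<open>The sampling model\<close>

locale glm =
  fixes M :: "'a measure" and N :: nat
    and Z :: "nat \<Rightarrow> 'a \<Rightarrow> (real ^ 'd) \<times> real" and D :: "((real ^ 'd) \<times> real) measure"
    and g c :: "real \<Rightarrow> real" and \<sigma> :: real and \<nu> :: "real \<Rightarrow> real measure"
    and \<theta>s :: "real ^ 'd" and \<Psi> :: "real ^ 'd \<Rightarrow> real"
  assumes model: "glm_sample M N Z D g c \<sigma> \<nu> \<theta>s" and norm: "is_norm \<Psi>"
begin

sublocale prob_space M using model by (simp add: glm_sample_def)

lemma N_pos: "0 < N" using model by (simp add: glm_sample_def)

lemma Z_measurable: "i \<in> {1..N} \<Longrightarrow> Z i \<in> borel_measurable M"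
  using model by (auto simp: glm_sample_def indep_vars_def)

lemma g_deriv: "(g has_real_derivative deriv g t) (at t)"
  "(deriv g has_real_derivative deriv (deriv g) t) (at t)" "0 < deriv (deriv g) t"
  using model by (auto simp: glm_sample_def DERIV_deriv_iff_real_differentiable)

lemma g_continuous [continuous_intros]:
  "continuous_on S f \<Longrightarrow> continuous_on S (\<lambda>x. g (f x))"
  "continuous_on S f \<Longrightarrow> continuous_on S (\<lambda>x. deriv g (f x))"
  using continuous_on_compose2[OF DERIV_continuous_on[OF has_field_derivative_at_within[OF g_deriv(1)]]]
    continuous_on_compose2[OF DERIV_continuous_on[OF has_field_derivative_at_within[OF g_deriv(2)]]]
  by blast+

lemma g_convex: "convex_on UNIV g"
  using g_deriv by (intro f''_ge0_imp_convex[where f' = "deriv g" and f'' = "deriv (deriv g)"])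
    (auto intro: less_imp_le)

lemma emp_avg_measurable:
  assumes "continuous_on UNIV f"
  shows "emp_avg N Z f \<in> borel_measurable M"
  unfolding emp_avg_def
  by (intro borel_measurable_divide borel_measurable_sum borel_measurable_const
      measurable_compose[OF Z_measurable] borel_measurable_continuous_onI assms)

text \<open>This is the Bregman divergence of the convex function \<open>g\<close>, nonnegative
  because \<open>g\<close> lies above its tangents.\<close>

lemma quad_Q_nonneg: "0 \<le> quad_Q g N \<theta>s v z"
proof -
  obtain x y where [simp]: "z = (x, y)" by fastforce
  have "deriv g (truncated N x \<bullet> \<theta>s) * (truncated N x \<bullet> (\<theta>s + v) - truncated N x \<bullet> \<theta>s)
      \<le> g (truncated N x \<bullet> (\<theta>s + v)) - g (truncated N x \<bullet> \<theta>s)"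
    by (rule convex_on_imp_above_tangent[OF g_convex]) (use g_deriv(1) in auto)
  then show ?thesis by (simp add: quad_Q_def inner_add_right)
qed

lemma quad_Q_scale: "1 \<le> t \<Longrightarrow> t * quad_Q g N \<theta>s v z \<le> quad_Q g N \<theta>s (t *\<^sub>R v) z"
  using convex_on_scale_increment[OF g_convex, of t "truncated N (fst z) \<bullet> \<theta>s" "truncated N (fst z) \<bullet> v"]
  by (cases z) (simp add: quad_Q_def inner_add_right algebra_simps)

lemma emp_Q_nonneg: "0 \<le> emp_avg N Z (quad_Q g N \<theta>s v) \<omega>"
  by (simp add: emp_avg_def sum_nonneg quad_Q_nonneg)

lemma emp_Q_scale:
  "1 \<le> t \<Longrightarrow> t * emp_avg N Z (quad_Q g N \<theta>s v) \<omega> \<le> emp_avg N Z (quad_Q g N \<theta>s (t *\<^sub>R v)) \<omega>"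
  unfolding emp_avg_mult[symmetric] by (intro emp_avg_mono quad_Q_scale)

text \<open>Additivity of the integral rests on the integrability clause of
  \<open>glm_sample\<close>.\<close>

lemma linear_drift_V: "linear (drift_V D g N \<theta>s)"
proof -
  let ?f = "\<lambda>v z. case z of (x, y) \<Rightarrow> (y - deriv g (truncated N x \<bullet> \<theta>s)) * (truncated N x \<bullet> v)"
  have int: "integrable D (?f v)" for v using model by (simp add: glm_sample_def)
  have "?f (v + w) = (\<lambda>z. ?f v z + ?f w z)" "?f (a *\<^sub>R v) = (\<lambda>z. a * ?f v z)" for v w a
    by (auto simp: algebra_simps inner_add_right)
  then show ?thesis
    using int by (intro linearI) (simp_all add: drift_V_def)
qed

lemma linear_emp_M: "linear (\<lambda>v. emp_avg N Z (mult_M D g N \<theta>s v) \<omega>)"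
proof -
  note V = linear_add[OF linear_drift_V] linear_scale[OF linear_drift_V]
  have "mult_M D g N \<theta>s (v + w) = (\<lambda>z. mult_M D g N \<theta>s v z + mult_M D g N \<theta>s w z)"
    "mult_M D g N \<theta>s (a *\<^sub>R v) = (\<lambda>z. a * mult_M D g N \<theta>s v z)" for v w a
    by (auto simp: mult_M_def V algebra_simps inner_add_right)
  then show ?thesis by (intro linearI) (simp_all add: emp_avg_add emp_avg_mult)
qed

lemma emp_M_measurable: "emp_avg N Z (mult_M D g N \<theta>s v) \<in> borel_measurable M"
  unfolding mult_M_def case_prod_beta by (intro emp_avg_measurable continuous_intros)

lemma emp_excess:
  "emp_avg N Z (excess_L D g \<Psi> N \<theta>s lam v) \<omega> =
    emp_avg N Z (quad_Q g N \<theta>s v) \<omega> - (emp_avg N Z (mult_M D g N \<theta>s v) \<omega> + drift_V D g N \<theta>s v)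
    + lam * (\<Psi> (\<theta>s + v) - \<Psi> \<theta>s)"
  unfolding excess_L_def by (simp add: emp_avg_add emp_avg_diff emp_avg_const N_pos)

text \<open>The drift and the terms with \<open>deriv g\<close> cancel between the three parts of
  the excess loss. Hence minimizers have nonpositive empirical excess, and measurability can be read
  off the objective.\<close>

lemma emp_excess_eq_objective_diff:
  "emp_avg N Z (excess_L D g \<Psi> N \<theta>s lam (\<theta> - \<theta>s)) \<omega> =
    objective g \<Psi> N Z lam \<omega> \<theta> - objective g \<Psi> N Z lam \<omega> \<theta>s"
proof -
  have "excess_L D g \<Psi> N \<theta>s lam (\<theta> - \<theta>s) = (\<lambda>z.
      (case z of (x, y) \<Rightarrow> g (truncated N x \<bullet> \<theta>)) - (case z of (x, y) \<Rightarrow> g (truncated N x \<bullet> \<theta>s))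
      - ((case z of (x, y) \<Rightarrow> y * (truncated N x \<bullet> \<theta>)) - (case z of (x, y) \<Rightarrow> y * (truncated N x \<bullet> \<theta>s)))
      + lam * (\<Psi> \<theta> - \<Psi> \<theta>s))"
    by (auto simp: excess_L_def quad_Q_def mult_M_def algebra_simps inner_diff_right)
  then show ?thesis
    by (simp only: objective_def emp_avg_add emp_avg_diff emp_avg_const[OF N_pos]) (simp add: algebra_simps)
qed

lemma objective_measurable: "(\<lambda>\<omega>. objective g \<Psi> N Z lam \<omega> \<theta>) \<in> borel_measurable M"
  unfolding objective_def case_prod_beta
  by (intro borel_measurable_add borel_measurable_uminus borel_measurable_const
      emp_avg_measurable continuous_intros)

lemma objective_continuous: "continuous_on UNIV (\<lambda>\<theta>. objective g \<Psi> N Z lam \<omega> \<theta>)"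
  unfolding objective_def emp_avg_def case_prod_beta
  by (intro continuous_intros is_norm_continuous norm) (use N_pos in auto)

text \<open>The final comparison of probabilities by inclusion requires the larger event to be
  measurable. The set of \<open>\<theta>\<close> outside \<open>C\<close> is open, so the exhaustion
  by compact sets applies.\<close>

lemma excess_pos_event_measurable:
  assumes "closed C"
  shows "{\<omega> \<in> space M. \<forall>\<theta>. \<theta> \<notin> C \<longrightarrow>
    0 < emp_avg N Z (excess_L D g \<Psi> N \<theta>s lam (\<theta> - \<theta>s)) \<omega>} \<in> sets M"
proof -
  have "{\<omega> \<in> space M. \<forall>\<theta>\<in>-C. 0 < objective g \<Psi> N Z lam \<omega> \<theta> - objective g \<Psi> N Z lam \<omega> \<theta>s} \<in> sets M"
    using assms by (intro sets_all_pos_open continuous_intros borel_measurable_diff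
        objective_measurable continuous_on_subset[OF objective_continuous]) auto
  then show ?thesis by (simp add: emp_excess_eq_objective_diff Ball_def)
qed

lemma in_estimators_iff:
  "\<theta> \<in> estimators g \<Psi> N Z lam \<omega> \<longleftrightarrow> (\<forall>\<eta>. objective g \<Psi> N Z lam \<omega> \<theta> \<le> objective g \<Psi> N Z lam \<omega> \<eta>)"
  by (auto simp: estimators_def is_arg_min_def not_less)

lemma estimator_event_measurable:
  "{\<omega> \<in> space M. \<forall>\<theta>\<in>estimators g \<Psi> N Z lam \<omega>. ereal (norm (\<theta> - \<theta>s)) \<le> b} \<in> sets M"
proof -
  have "closed {\<theta>. ereal (norm (\<theta> - \<theta>s)) \<le> b}" by (intro closed_Collect_le continuous_intros)
  from sets_all_minimizers_in_closed[OF this objective_continuous objective_measurable]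
  show ?thesis by (simp add: Ball_def in_estimators_iff)
qed

section \<open>Characterizations of the three sets of levels\<close>

lemma levels_V_iff:
  assumes "0 \<le> L" "0 < \<rho>"
  shows "s \<in> levels_V D g \<Psi> N \<theta>s L \<rho> \<longleftrightarrow>
    0 < s \<and> (\<forall>w. \<bar>drift_V D g N \<theta>s w\<bar> \<le> L * s * max (norm w) (s * \<Psi> w / \<rho>))"
  using linear_bound_on_balls_iff[OF norm linear_drift_V _ assms(2,1), of s \<theta>s]
  by (auto simp: levels_V_def SUP_le_iff)

lemma levels_M_iff:
  assumes "0 \<le> L" "0 < \<rho>"
  shows "s \<in> levels_M M Z D g \<Psi> N \<theta>s L p \<rho> \<longleftrightarrow>
    0 < s \<and> 1 - p \<le> prob {\<omega> \<in> space M.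
      \<forall>w. \<bar>emp_avg N Z (mult_M D g N \<theta>s w) \<omega>\<bar> \<le> L * s * max (norm w) (s * \<Psi> w / \<rho>)}"
  using linear_bound_on_balls_iff[OF norm linear_emp_M _ assms(2,1), of s \<theta>s]
  by (simp add: levels_M_def SUP_le_iff cong: conj_cong)

lemma levels_Q_iff:
  "s \<in> levels_Q M Z g \<Psi> N \<theta>s L p \<rho> \<longleftrightarrow>
    0 < s \<and> 1 - p \<le> prob {\<omega> \<in> space M. \<forall>\<theta>\<in>sphere \<theta>s s \<inter> norm_ball \<Psi> \<theta>s \<rho>.
      L * s\<^sup>2 \<le> emp_avg N Z (quad_Q g N \<theta>s (\<theta> - \<theta>s)) \<omega>}"
  by (simp add: levels_Q_def le_INF_iff)

end

section \<open>The radius\<close>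

lemma Inf_sequence:
  fixes X :: "real set"
  assumes "X \<noteq> {}" "bdd_below X"
  obtains s where "\<And>n. s n \<in> X" "\<And>n. Inf X \<le> s n" "s \<longlonglongrightarrow> Inf X"
proof -
  have "\<exists>x\<in>X. x < Inf X + inverse (real (Suc n))" for n
    using assms by (intro cInf_lessD) auto
  then obtain s where s: "\<And>n. s n \<in> X" "\<And>n. s n < Inf X + inverse (real (Suc n))" by metis
  have le: "Inf X \<le> s n" for n using s(1) assms(2) by (rule cInf_lower)
  have "(\<lambda>n. Inf X + inverse (real (Suc n))) \<longlonglongrightarrow> Inf X + 0"
    by (intro tendsto_intros LIMSEQ_inverse_real_of_nat)
  then have "s \<longlonglongrightarrow> Inf X"
    using tendsto_sandwich[of "\<lambda>_. Inf X" s sequentially "\<lambda>n. Inf X + inverse (real (Suc n))" "Inf X"]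
      le less_imp_le[OF s(2)] by simp
  with s(1) le that show thesis by blast
qed

context glm
begin

lemma levels_pos:
  "s \<in> levels_Q M Z g \<Psi> N \<theta>s L p \<rho> \<Longrightarrow> 0 < s"
  "s \<in> levels_M M Z D g \<Psi> N \<theta>s L p \<rho> \<Longrightarrow> 0 < s"
  "s \<in> levels_V D g \<Psi> N \<theta>s L \<rho> \<Longrightarrow> 0 < s"
  by (auto simp: levels_Q_def levels_M_def levels_V_def)

lemma levels_bdd_below:
  "bdd_below (levels_Q M Z g \<Psi> N \<theta>s L p \<rho>)"
  "bdd_below (levels_M M Z D g \<Psi> N \<theta>s L p \<rho>)"
  "bdd_below (levels_V D g \<Psi> N \<theta>s L \<rho>)"
  using levels_pos by (auto intro!: bdd_belowI[of _ 0] less_imp_le)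

text \<open>A linear functional in finite dimension is bounded by some \<open>B\<close>, and the
  level \<open>B / L\<close> is chosen so that \<open>L * s = B\<close>.\<close>

lemma levels_V_nonempty:
  assumes "0 < L" "0 < \<rho>"
  shows "levels_V D g \<Psi> N \<theta>s L \<rho> \<noteq> {}"
proof -
  obtain B where B: "0 < B" "\<And>w. norm (drift_V D g N \<theta>s w) \<le> B * norm w"
    using linear_bounded_pos[OF linear_drift_V] by blast
  have "\<bar>drift_V D g N \<theta>s w\<bar> \<le> L * (B / L) * max (norm w) (B / L * \<Psi> w / \<rho>)" for w
    using B(2)[of w] B(1) assms(1) by (smt (verit) mult_left_mono nonzero_mult_div_cancel_left real_norm_def times_divide_eq_right)
  then have "B / L \<in> levels_V D g \<Psi> N \<theta>s L \<rho>" using B(1) assms by (simp add: levels_V_iff)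
  then show ?thesis by blast
qed

text \<open>The bound of the linear functional depends on \<open>\<omega>\<close>, so no level works
  surely. The events for the levels \<open>Suc n\<close> increase to the whole space, so their
  probabilities eventually exceed \<open>1 - p\<close>.\<close>

lemma levels_M_nonempty:
  assumes "0 < L" "0 < \<rho>" "0 < p"
  shows "levels_M M Z D g \<Psi> N \<theta>s L p \<rho> \<noteq> {}"
proof -
  let ?m = "\<lambda>w \<omega>. emp_avg N Z (mult_M D g N \<theta>s w) \<omega>"
  define F where "F n = {\<omega> \<in> space M. \<forall>w. \<bar>?m w \<omega>\<bar> \<le> L * real (Suc n) * max (norm w) (real (Suc n) * \<Psi> w / \<rho>)}" for n
  have cont: "continuous_on UNIV (\<lambda>w. ?m w \<omega>)" for \<omega>
    using linear_emp_M by (simp add: linear_continuous_on linear_conv_bounded_linear)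
  have "{\<omega> \<in> space M. \<forall>w\<in>UNIV. 0 \<le> L * real (Suc n) * max (norm w) (real (Suc n) * \<Psi> w / \<rho>) - \<bar>?m w \<omega>\<bar>} \<in> events" for n
    using assms by (intro sets_all_nonneg continuous_intros cont is_norm_continuous norm
        borel_measurable_diff borel_measurable_const borel_measurable_abs emp_M_measurable) auto
  then have F: "F n \<in> events" for n by (simp add: F_def)
  have mono: "F i \<subseteq> F j" if "i \<le> j" for i j
    unfolding F_def using that assms
    by (auto intro!: order_trans[OF _ ball_bound_mono[of L "real (Suc i)" "real (Suc j)" \<rho>]]
        simp: is_norm_nonneg[OF norm] simp del: of_nat_Suc)
  have "(\<Union>n. F n) = space M"
  proof (intro equalityI subsetI)
    fix \<omega> assume \<omega>: "\<omega> \<in> space M"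
    obtain B where B: "0 < B" "\<And>w. norm (?m w \<omega>) \<le> B * norm w"
      using linear_bounded_pos[OF linear_emp_M] by blast
    obtain n where "B / L \<le> real n" using real_arch_simple by blast
    then have n: "B \<le> L * real (Suc n)" using assms(1) by (simp add: field_simps)
    have "\<bar>?m w \<omega>\<bar> \<le> L * real (Suc n) * max (norm w) (real (Suc n) * \<Psi> w / \<rho>)" for w
    proof -
      have "\<bar>?m w \<omega>\<bar> \<le> B * norm w" using B(2) by simp
      also have "\<dots> \<le> L * real (Suc n) * max (norm w) (real (Suc n) * \<Psi> w / \<rho>)"
        using n B(1) by (intro mult_mono) auto
      finally show ?thesis .
    qed
    then show "\<omega> \<in> (\<Union>n. F n)" using \<omega> by (auto simp: F_def)
  qed (auto simp: F_def)
  moreover have "(\<lambda>n. prob (F n)) \<longlonglongrightarrow> prob (\<Union>n. F n)"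
    using F mono by (intro finite_Lim_measure_incseq) (auto simp: incseq_def)
  ultimately have "(\<lambda>n. prob (F n)) \<longlonglongrightarrow> 1" by (simp add: prob_space)
  then have "\<forall>\<^sub>F n in sequentially. 1 - p < prob (F n)"
    using assms(3) by (intro order_tendstoD) auto
  then obtain n where "1 - p \<le> prob (F n)"
    by (meson eventually_sequentially less_imp_le order_refl)
  then have "real (Suc n) \<in> levels_M M Z D g \<Psi> N \<theta>s L p \<rho>"
    using assms by (simp add: levels_M_iff F_def)
  then show ?thesis by blast
qed

text \<open>A sphere too large to meet the bounded \<open>\<Psi>\<close>-ball makes the condition
  vacuous, so it holds with probability 1.\<close>

lemma levels_Q_nonempty:
  assumes "0 < \<rho>" "0 < p"
  shows "levels_Q M Z g \<Psi> N \<theta>s L p \<rho> \<noteq> {}"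
proof -
  obtain C where C: "0 < C" "\<And>v. norm v \<le> C * \<Psi> v" using is_norm_bounds_norm[OF norm] by blast
  have "norm (\<theta> - \<theta>s) \<le> C * \<rho>" if "\<theta> \<in> norm_ball \<Psi> \<theta>s \<rho>" for \<theta>
    using order_trans[OF C(2) mult_left_mono[of "\<Psi> (\<theta> - \<theta>s)" \<rho> C]] that C(1)
    by (simp add: norm_ball_def)
  then have "sphere \<theta>s (C * \<rho> + 1) \<inter> norm_ball \<Psi> \<theta>s \<rho> = {}"
    by (force simp: dist_norm norm_minus_commute)
  then have "C * \<rho> + 1 \<in> levels_Q M Z g \<Psi> N \<theta>s L p \<rho>"
    using C(1) assms by (simp add: levels_Q_iff prob_space add_pos_pos)
  then show ?thesis by blast
qed

text \<open>This carries all the probability in the argument: on \<open>A\<close> the deterministic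
  estimates apply at \<open>r\<close> itself, although \<open>r\<close> is built from infima that
  need not be attained.\<close>

lemma radius_good_event:
  fixes LQ LM LV pQ pM \<rho> :: real
  defines "r \<equiv> radius M Z D g \<Psi> N \<theta>s LQ LM LV pQ pM \<rho>"
  assumes L: "0 < LQ" "0 < LM" "0 < LV" and p: "0 < pQ" "pQ < 1" "0 < pM" "pM < 1"
    and \<rho>: "0 < \<rho>"
    and level: "radius_Q M Z g \<Psi> N \<theta>s LQ pQ \<rho> < r \<longrightarrow> r \<in> levels_Q M Z g \<Psi> N \<theta>s LQ pQ \<rho>"
  obtains A where "A \<in> events" "1 - pQ - pM \<le> prob A"
    "\<And>\<omega> v. \<omega> \<in> A \<Longrightarrow> \<bar>emp_avg N Z (mult_M D g N \<theta>s v) \<omega> + drift_V D g N \<theta>s v\<bar>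
        \<le> (LM + LV) * r * max (norm v) (r * \<Psi> v / \<rho>)"
    "\<And>\<omega> v. \<omega> \<in> A \<Longrightarrow> r < norm v \<Longrightarrow> r * \<Psi> v < \<rho> * norm v \<Longrightarrow>
        LQ * r * norm v \<le> emp_avg N Z (quad_Q g N \<theta>s v) \<omega> \<and>
        0 < emp_avg N Z (quad_Q g N \<theta>s v) \<omega>"
    "0 \<le> r"
proof -
  let ?XQ = "levels_Q M Z g \<Psi> N \<theta>s LQ pQ \<rho>" and ?XM = "levels_M M Z D g \<Psi> N \<theta>s LM pM \<rho>"
    and ?XV = "levels_V D g \<Psi> N \<theta>s LV \<rho>"
  let ?m = "\<lambda>w \<omega>. emp_avg N Z (mult_M D g N \<theta>s w) \<omega>"
    and ?q = "\<lambda>w \<omega>. emp_avg N Z (quad_Q g N \<theta>s w) \<omega>"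
  have r: "Inf ?XQ \<le> r" "Inf ?XM \<le> r" "Inf ?XV \<le> r"
    by (auto simp: r_def radius_def radius_Q_def)
  obtain sV where sV: "\<And>n. sV n \<in> ?XV" "\<And>n. Inf ?XV \<le> sV n" "sV \<longlonglongrightarrow> Inf ?XV"
    using Inf_sequence[OF levels_V_nonempty[OF L(3) \<rho>] levels_bdd_below(3)] by blast
  obtain sM where sM: "\<And>n. sM n \<in> ?XM" "\<And>n. Inf ?XM \<le> sM n" "sM \<longlonglongrightarrow> Inf ?XM"
    using Inf_sequence[OF levels_M_nonempty[OF L(2) \<rho> p(3)] levels_bdd_below(2)] by blast
  have Inf_nonneg: "0 \<le> Inf ?XV" "0 \<le> Inf ?XM"
    using LIMSEQ_le_const[OF sV(3), of 0] LIMSEQ_le_const[OF sM(3), of 0]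
      levels_pos(3)[OF sV(1)] levels_pos(2)[OF sM(1)] by (simp_all add: less_imp_le)
  then have r0: "0 \<le> r" using r by linarith
  \<comment> \<open>\<open>levels_Q\<close> need not be upward closed. If \<open>r\<close> exceeds
    \<open>radius_Q\<close>, the hypothesis \<open>level\<close> allows the constant sequence;
    otherwise \<open>r\<close> is the infimum and is approached from above.\<close>
  obtain sQ where sQ: "\<And>n. sQ n \<in> ?XQ" "\<And>n. r \<le> sQ n" "sQ \<longlonglongrightarrow> r"
  proof (cases "radius_Q M Z g \<Psi> N \<theta>s LQ pQ \<rho> < r")
    case True
    show ?thesis by (rule that[of "\<lambda>_. r"]) (use True level in auto)
  next
    case False
    then have "r = Inf ?XQ" using r(1) by (simp add: radius_Q_def)
    then show ?thesis
      using Inf_sequence[OF levels_Q_nonempty levels_bdd_below(1), of \<rho> pQ LQ] \<rho> p that by metis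
  qed
  \<comment> \<open>The levels tend to the infimum of their own set, which may be below
    \<open>r\<close>; monotonicity of the bound in the level raises it to \<open>r\<close>.\<close>
  have V: "\<bar>drift_V D g N \<theta>s w\<bar> \<le> LV * r * max (norm w) (r * \<Psi> w / \<rho>)" for w
  proof -
    have "\<bar>drift_V D g N \<theta>s w\<bar> \<le> LV * sV n * max (norm w) (sV n * \<Psi> w / \<rho>)" for n
      using sV(1)[of n] L \<rho> by (simp add: levels_V_iff)
    then have "\<bar>drift_V D g N \<theta>s w\<bar> \<le> LV * Inf ?XV * max (norm w) (Inf ?XV * \<Psi> w / \<rho>)"
      by (intro bound_at_limit[OF _ sV(3) \<rho>]) simp
    also have "\<dots> \<le> LV * r * max (norm w) (r * \<Psi> w / \<rho>)"
      using L \<rho> r Inf_nonneg by (intro ball_bound_mono is_norm_nonneg[OF norm]) auto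
    finally show ?thesis .
  qed
  define EM where "EM n = {\<omega> \<in> space M. \<forall>w. \<bar>?m w \<omega>\<bar> \<le> LM * sM n * max (norm w) (sM n * \<Psi> w / \<rho>)}" for n
  define EQ where "EQ n = {\<omega> \<in> space M. \<forall>\<theta>\<in>sphere \<theta>s (sQ n) \<inter> norm_ball \<Psi> \<theta>s \<rho>.
    LQ * (sQ n)\<^sup>2 \<le> ?q (\<theta> - \<theta>s) \<omega>}" for n
  have probs: "1 - pM \<le> prob (EM n)" "1 - pQ \<le> prob (EQ n)" for n
    using sM(1)[of n] sQ(1)[of n] L \<rho> by (simp_all add: EM_def EQ_def levels_M_iff levels_Q_iff)
  \<comment> \<open>Nonmeasurable sets have measure 0 by convention, whereas these sets have measure
    at least \<open>1 - pM\<close> or \<open>1 - pQ\<close>, both positive.\<close>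
  have events: "EM n \<in> events" "EQ n \<in> events" for n
    using probs[of n] p measure_notin_sets[of _ M] by force+
  let ?A = "{\<omega> \<in> space M. \<exists>\<^sub>\<infinity>n. \<omega> \<in> EM n}" and ?B = "{\<omega> \<in> space M. \<exists>\<^sub>\<infinity>n. \<omega> \<in> EQ n}"
  note A = prob_frequently_ge[where E = EM, OF prob_space_axioms events(1) probs(1)]
  note B = prob_frequently_ge[where E = EQ, OF prob_space_axioms events(2) probs(2)]
  show thesis
  proof (rule that[of "?A \<inter> ?B"])
    show "?A \<inter> ?B \<in> events" using A(1) B(1) by blast
    have "prob (?A \<union> ?B) = prob ?A + prob ?B - prob (?A \<inter> ?B)"
      using A(1) B(1) by (simp add: measure_Un3 fmeasurable_eq_sets)
    then show "1 - pQ - pM \<le> prob (?A \<inter> ?B)"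
      using A(2) B(2) prob_le_1[of "?A \<union> ?B"] by linarith
  next
    fix \<omega> v assume \<omega>: "\<omega> \<in> ?A \<inter> ?B"
    have "\<exists>\<^sub>\<infinity>n. \<bar>?m v \<omega>\<bar> \<le> LM * sM n * max (norm v) (sM n * \<Psi> v / \<rho>)"
      using \<omega> by (auto simp: EM_def elim!: INFM_mono)
    then have "\<bar>?m v \<omega>\<bar> \<le> LM * Inf ?XM * max (norm v) (Inf ?XM * \<Psi> v / \<rho>)"
      by (rule bound_at_limit[OF _ sM(3) \<rho>])
    also have "\<dots> \<le> LM * r * max (norm v) (r * \<Psi> v / \<rho>)"
      using L \<rho> r Inf_nonneg by (intro ball_bound_mono is_norm_nonneg[OF norm]) auto
    finally show "\<bar>?m v \<omega> + drift_V D g N \<theta>s v\<bar> \<le> (LM + LV) * r * max (norm v) (r * \<Psi> v / \<rho>)"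
      using V[of v] by (simp add: distrib_right)
    have "\<exists>\<^sub>\<infinity>n. \<forall>\<theta>\<in>sphere \<theta>s (sQ n) \<inter> norm_ball \<Psi> \<theta>s \<rho>. LQ * (sQ n)\<^sup>2 \<le> ?q (\<theta> - \<theta>s) \<omega>"
      using \<omega> by (auto simp: EQ_def elim!: INFM_mono)
    from quadratic_bound_at_limit[OF norm L(1) \<rho> levels_pos(1)[OF sQ(1)] sQ(2,3) emp_Q_scale this]
    show "LQ * r * norm v \<le> ?q v \<omega> \<and> 0 < ?q v \<omega>" if "r < norm v" "r * \<Psi> v < \<rho> * norm v"
      using that by blast
  qed (rule r0)
qed

end

theorem theorem2p3p1:
  fixes M :: "'a measure" and N :: nat
    and Z :: "nat \<Rightarrow> 'a \<Rightarrow> (real ^ 'd) \<times> real" and D :: "((real ^ 'd) \<times> real) measure"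
    and g c :: "real \<Rightarrow> real" and \<sigma> :: real and \<nu> :: "real \<Rightarrow> real measure"
    and \<theta>s :: "real ^ 'd" and \<Psi> :: "real ^ 'd \<Rightarrow> real"
    and LQ LM LV pQ pM :: real
  assumes model: "glm_sample M N Z D g c \<sigma> \<nu> \<theta>s"
    and norm: "is_norm \<Psi>"
    and constants: "0 < LQ" "0 < LM" "0 < LV"
    and probabilities: "0 < pQ" "pQ < 1" "0 < pM" "pM < 1"
  shows
    "(\<forall>\<rho> lam c1 c2.
        let r = radius M Z D g \<Psi> N \<theta>s LQ LM LV pQ pM \<rho> in
        0 < \<rho> \<and>
        (radius_Q M Z g \<Psi> N \<theta>s LQ pQ \<rho> < r \<longrightarrow> r \<in> levels_Q M Z g \<Psi> N \<theta>s LQ pQ \<rho>) \<and>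
        c1 * (r\<^sup>2 / \<rho>) \<le> lam \<and> lam \<le> c2 * (r\<^sup>2 / \<rho>) \<and>
        LQ > LM + LV + c2 \<and> c1 \<ge> 8 * (LM + LV) \<and>
        sparsity_Delta \<Psi> \<theta>s r \<rho> \<ge> ereal (3/4 * \<rho>)
        \<longrightarrow>
        measure M {\<omega> \<in> space M. \<forall>\<theta>. \<theta> \<notin> cball \<theta>s r \<inter> norm_ball \<Psi> \<theta>s \<rho> \<longrightarrow>
            emp_avg N Z (excess_L D g \<Psi> N \<theta>s lam (\<theta> - \<theta>s)) \<omega> > 0} \<ge> 1 - pQ - pM)
     \<and>
     (\<forall>\<rho> lam c1 k.
        let r = radius M Z D g \<Psi> N \<theta>s LQ LM LV pQ pM \<rho> in
        0 < \<rho> \<and>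
        (radius_Q M Z g \<Psi> N \<theta>s LQ pQ \<rho> < r \<longrightarrow> r \<in> levels_Q M Z g \<Psi> N \<theta>s LQ pQ \<rho>) \<and>
        \<rho> = k * \<Psi> \<theta>s \<and> k > 4 \<and>
        lam \<ge> c1 * (r\<^sup>2 / \<rho>) \<and> c1 > 8 * (LM + LV) \<and> LQ > LM + LV
        \<longrightarrow>
        measure M {\<omega> \<in> space M. \<forall>\<theta>hat \<in> estimators g \<Psi> N Z lam \<omega>.
            ereal (norm (\<theta>hat - \<theta>s))
              \<le> max (ereal r)
                    (ereal lam / ereal (r * (LQ - LM - LV)) * ereal (\<Psi> \<theta>s))} \<ge> 1 - pQ - pM)"
  (is "?part1 \<and> ?part2")
proof
  interpret glm M N Z D g c \<sigma> \<nu> \<theta>s \<Psi> using model norm by unfold_locales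
  have \<kappa>: "0 < LM + LV" using constants by simp
  show ?part1
    unfolding Let_def
  proof (intro allI impI, elim conjE)
    fix \<rho> lam c1 c2 :: real
    let ?r = "radius M Z D g \<Psi> N \<theta>s LQ LM LV pQ pM \<rho>"
    let ?C = "cball \<theta>s ?r \<inter> norm_ball \<Psi> \<theta>s \<rho>"
    assume \<rho>: "0 < \<rho>"
      and level: "radius_Q M Z g \<Psi> N \<theta>s LQ pQ \<rho> < ?r \<longrightarrow> ?r \<in> levels_Q M Z g \<Psi> N \<theta>s LQ pQ \<rho>"
      and lam: "c1 * (?r\<^sup>2 / \<rho>) \<le> lam" "lam \<le> c2 * (?r\<^sup>2 / \<rho>)" "LM + LV + c2 < LQ" "8 * (LM + LV) \<le> c1"
      and sparse: "ereal (3/4 * \<rho>) \<le> sparsity_Delta \<Psi> \<theta>s ?r \<rho>"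
    obtain A where A: "A \<in> events" "1 - pQ - pM \<le> prob A"
      and good: "\<And>\<omega> v. \<omega> \<in> A \<Longrightarrow> \<bar>emp_avg N Z (mult_M D g N \<theta>s v) \<omega> + drift_V D g N \<theta>s v\<bar>
          \<le> (LM + LV) * ?r * max (norm v) (?r * \<Psi> v / \<rho>)"
        "\<And>\<omega> v. \<omega> \<in> A \<Longrightarrow> ?r < norm v \<Longrightarrow> ?r * \<Psi> v < \<rho> * norm v \<Longrightarrow>
          LQ * ?r * norm v \<le> emp_avg N Z (quad_Q g N \<theta>s v) \<omega> \<and>
          0 < emp_avg N Z (quad_Q g N \<theta>s v) \<omega>"
      and r0: "0 \<le> ?r"
      by (rule radius_good_event[OF constants probabilities \<rho> level]) (rule that)
    have "closed ?C"
      unfolding norm_ball_def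
      by (intro closed_Int closed_cball closed_Collect_le continuous_intros
          continuous_on_compose2[OF is_norm_continuous[OF norm]]) auto
    then have meas: "{\<omega> \<in> space M. \<forall>\<theta>. \<theta> \<notin> ?C \<longrightarrow>
        0 < emp_avg N Z (excess_L D g \<Psi> N \<theta>s lam (\<theta> - \<theta>s)) \<omega>} \<in> events"
      by (rule excess_pos_event_measurable)
    \<comment> \<open>The drift is deterministic and is added to the multiplier term, so
      \<open>excess_pos_outside\<close> is used with \<open>LM + LV\<close> as \<kappa>.\<close>
    have "0 < emp_avg N Z (excess_L D g \<Psi> N \<theta>s lam (\<theta> - \<theta>s)) \<omega>" if "\<omega> \<in> A" "\<theta> \<notin> ?C" for \<omega> \<theta>
      unfolding emp_excess
      using that(2)
      by (intro excess_pos_outside[OF norm \<rho> r0 \<kappa> emp_Q_nonneg good(2)[OF that(1)] good(1)[OF that(1)]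
            lam(1,2,4,3) sparse])
        (auto simp: dist_norm norm_minus_commute norm_ball_def)
    then have "prob A \<le> prob {\<omega> \<in> space M. \<forall>\<theta>. \<theta> \<notin> ?C \<longrightarrow>
        0 < emp_avg N Z (excess_L D g \<Psi> N \<theta>s lam (\<theta> - \<theta>s)) \<omega>}"
      using sets.sets_into_space[OF A(1)] by (intro finite_measure_mono meas) blast
    then show "1 - pQ - pM \<le> prob {\<omega> \<in> space M. \<forall>\<theta>. \<theta> \<notin> ?C \<longrightarrow>
        0 < emp_avg N Z (excess_L D g \<Psi> N \<theta>s lam (\<theta> - \<theta>s)) \<omega>}"
      using A(2) by linarith
  qed
  show ?part2
    unfolding Let_def
  proof (intro allI impI, elim conjE)
    fix \<rho> lam c1 k :: real
    let ?r = "radius M Z D g \<Psi> N \<theta>s LQ LM LV pQ pM \<rho>"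
    let ?b = "max (ereal ?r) (ereal lam / ereal (?r * (LQ - LM - LV)) * ereal (\<Psi> \<theta>s))"
    assume \<rho>: "0 < \<rho>"
      and level: "radius_Q M Z g \<Psi> N \<theta>s LQ pQ \<rho> < ?r \<longrightarrow> ?r \<in> levels_Q M Z g \<Psi> N \<theta>s LQ pQ \<rho>"
      and k: "\<rho> = k * \<Psi> \<theta>s" "4 < k"
      and lam: "c1 * (?r\<^sup>2 / \<rho>) \<le> lam" "8 * (LM + LV) < c1" "LM + LV < LQ"
    obtain A where A: "A \<in> events" "1 - pQ - pM \<le> prob A"
      and good: "\<And>\<omega> v. \<omega> \<in> A \<Longrightarrow> \<bar>emp_avg N Z (mult_M D g N \<theta>s v) \<omega> + drift_V D g N \<theta>s v\<bar>
          \<le> (LM + LV) * ?r * max (norm v) (?r * \<Psi> v / \<rho>)"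
        "\<And>\<omega> v. \<omega> \<in> A \<Longrightarrow> ?r < norm v \<Longrightarrow> ?r * \<Psi> v < \<rho> * norm v \<Longrightarrow>
          LQ * ?r * norm v \<le> emp_avg N Z (quad_Q g N \<theta>s v) \<omega> \<and>
          0 < emp_avg N Z (quad_Q g N \<theta>s v) \<omega>"
      and r0: "0 \<le> ?r"
      by (rule radius_good_event[OF constants probabilities \<rho> level]) (rule that)
    have "ereal (norm (\<theta> - \<theta>s)) \<le> ?b" if "\<omega> \<in> A" "\<theta> \<in> estimators g \<Psi> N Z lam \<omega>" for \<omega> \<theta>
    proof -
      \<comment> \<open>The objective at a minimizer is at most its value at
        \<open>\<theta>s\<close>.\<close>
      have "emp_avg N Z (excess_L D g \<Psi> N \<theta>s lam (\<theta> - \<theta>s)) \<omega> \<le> 0"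
        using that(2) by (simp add: emp_excess_eq_objective_diff in_estimators_iff)
      from excess_nonpos_bound[OF norm \<rho> r0 \<kappa> emp_Q_nonneg good(2)[OF that(1)] good(1)[OF that(1)]
          lam k this[unfolded emp_excess]]
      show ?thesis by (simp add: diff_diff_eq)
    qed
    then have "prob A \<le> prob {\<omega> \<in> space M. \<forall>\<theta>\<in>estimators g \<Psi> N Z lam \<omega>. ereal (norm (\<theta> - \<theta>s)) \<le> ?b}"
      using sets.sets_into_space[OF A(1)] by (intro finite_measure_mono estimator_event_measurable) blast
    then show "1 - pQ - pM \<le> prob {\<omega> \<in> space M. \<forall>\<theta>\<in>estimators g \<Psi> N Z lam \<omega>. ereal (norm (\<theta> - \<theta>s)) \<le> ?b}"
      using A(2) by linarith
  qed
qed

end
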